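(* For every integer $m\ge1$, the smallest weighted efficiency $\rho_{2,m}$ of triangulations of $I^2\times\Delta^{m-1}$ is $$\rho_{2,m}=\sqrt{\frac{\lceil 3m^2/4\rceil}{m^2}} .$$ That is, $\rho_{2,m}=\sqrt{3/4}$ for even $m$ and $\rho_{2,m}=\sqrt{3/4}+\Theta(m^{-2})$ for odd $m$.
   Context: $I^2=[0,1]^2$ and $\Delta^{m-1}$ is an $(m-1)$-simplex with vertices $v_1,\dots,v_m$. A triangulation of a $d$-dimensional polytope is a decomposition of it into $d$-simplices that use as vertices only vertices of the polytope and that intersect face to face. Simplices are identified with their vertex sets. An $(m+1)$-dimensional simplex $\tau$ with vertices among the vertices of $I^2\times\Delta^{m-1}$ decomposes as $\tau=\tau_1\cup\dots\cup\tau_m$ with $\tau_i\subset I^2\times\{v_i\}$; its type is $(t_1,\dots,t_m)=(|\tau_1|-1,\dots,|\tau_m|-1)$ and its weight is $\operatorname{weight}(\tau)=\frac1{\prod_{i=1}^m t_i!}$. The weighted efficiency of a triangulation $T$ of $I^2\times\Delta^{m-1}$ is $\sqrt{\frac{\sum_{\tau\in T}\operatorname{weight}(\tau)}{m^2}}$, the sum being over the full-dimensional simplices of $T$, and $\rho_{2,m}$ is the minimum of this number over all triangulations $T$ of $I^2\times\Delta^{m-1}$. *)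

theory Defs
  imports
    "HOL-Analysis.Analysis"
    "HOL-Analysis.Finite_Function_Topology"
    "HOL-Library.Landau_Symbols"
begin

text \<open>
  The number \<open>m\<close> of vertices of the simplex varies inside the statement, so the simplex is realised
  in the space \<open>nat \<Rightarrow>\<^sub>0 real\<close> of finitely supported sequences, as the convex hull of its first \<open>m\<close>
  unit vectors (indexed from \<open>1\<close>).
\<close>

definition square :: "(real \<times> real) set" where
  "square = {0..1} \<times> {0..1}"

definition simplex_vertex :: "nat \<Rightarrow> nat \<Rightarrow>\<^sub>0 real" where
  "simplex_vertex i = Poly_Mapping.single i 1"

definition std_simplex :: "nat \<Rightarrow> (nat \<Rightarrow>\<^sub>0 real) set" where
  "std_simplex m = convex hull (simplex_vertex ` {1..m})"

definition square_times_simplex :: "nat \<Rightarrow> ((real \<times> real) \<times> (nat \<Rightarrow>\<^sub>0 real)) set" where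
  "square_times_simplex m = square \<times> std_simplex m"

text \<open>
  A triangulation of a \<open>d\<close>-dimensional polytope is given by the set of its \<open>d\<close>-dimensional simplices,
  each identified with its vertex set. The library predicates \<open>simplex\<close> and \<open>triangulation\<close> are
  restricted to the class \<open>euclidean_space\<close>, so their defining conditions are written out here.
  The face condition refers to both simplices because \<open>\<sigma>\<close> and \<open>\<tau>\<close> may be exchanged.
\<close>

definition triangulates :: "'a::real_vector set set \<Rightarrow> nat \<Rightarrow> 'a set \<Rightarrow> bool" where
  "triangulates T d P \<longleftrightarrow>
     finite T \<and>
     (\<forall>\<tau>\<in>T. \<tau> \<subseteq> {v. v extreme_point_of P} \<and> \<not> affine_dependent \<tau> \<and> card \<tau> = d + 1) \<and>
     (\<Union>\<tau>\<in>T. convex hull \<tau>) = P \<and>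
     (\<forall>\<sigma>\<in>T. \<forall>\<tau>\<in>T. (convex hull \<sigma> \<inter> convex hull \<tau>) face_of (convex hull \<sigma>))"

definition triangulations :: "nat \<Rightarrow> ((real \<times> real) \<times> (nat \<Rightarrow>\<^sub>0 real)) set set set" where
  "triangulations m = {T. triangulates T (m + 1) (square_times_simplex m)}"

text \<open>
  For a full-dimensional simplex no \<open>part \<tau> i\<close> with \<open>1 \<le> i \<le> m\<close> is empty, so the subtraction below
  does not truncate.
\<close>

definition part :: "((real \<times> real) \<times> (nat \<Rightarrow>\<^sub>0 real)) set \<Rightarrow> nat
    \<Rightarrow> ((real \<times> real) \<times> (nat \<Rightarrow>\<^sub>0 real)) set" where
  "part \<tau> i = \<tau> \<inter> (square \<times> {simplex_vertex i})"

definition simplex_type :: "((real \<times> real) \<times> (nat \<Rightarrow>\<^sub>0 real)) set \<Rightarrow> nat \<Rightarrow> nat" where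
  "simplex_type \<tau> i = card (part \<tau> i) - 1"

definition weight :: "nat \<Rightarrow> ((real \<times> real) \<times> (nat \<Rightarrow>\<^sub>0 real)) set \<Rightarrow> real" where
  "weight m \<tau> = 1 / (\<Prod>i=1..m. fact (simplex_type \<tau> i))"

definition weighted_efficiency :: "nat \<Rightarrow> ((real \<times> real) \<times> (nat \<Rightarrow>\<^sub>0 real)) set set \<Rightarrow> real" where
  "weighted_efficiency m T = sqrt ((\<Sum>\<tau>\<in>T. weight m \<tau>) / (real m)\<^sup>2)"

text \<open>
  There are only finitely many vertices, hence finitely many triangulations, so this \<open>Min\<close> is a
  genuine minimum.
\<close>

definition rho2 :: "nat \<Rightarrow> real" where
  "rho2 m = Min (weighted_efficiency m ` triangulations m)"

end

theory Submission
  imports Defs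
begin

text \<open>
  By the Cayley trick, slicing the simplices of a triangulation of \<open>I\<^sup>2 \<times> \<Delta>\<^bsup>m-1\<^esup>\<close> at the barycentre of the
  simplex tiles a square of side \<open>m\<close> by triangles of area \<open>1/2\<close>, parallelograms of area \<open>1\<close>, and
  parallelograms of area \<open>2\<close> spanned by a diagonal of one copy of \<open>I\<^sup>2\<close> and an antidiagonal of another.
  Area and weight agree except in the last case, where the weight is \<open>1\<close>; hence the weights add up to
  \<open>m\<^sup>2\<close> minus the number of double parallelograms. Every copy of \<open>I\<^sup>2\<close> is cut by only one of its two
  diagonals, and a given pair of copies yields at most one double parallelogram, so there are at most
  \<open>\<lfloor>m\<^sup>2/4\<rfloor>\<close> of them. The bound is attained by a regular triangulation: half of the tropical curves dual
  to the copies of \<open>I\<^sup>2\<close> get a long segment of slope \<open>-1\<close> and half a long segment of slope \<open>1\<close>, and any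
  two segments of different slope cross.
\<close>

section \<open>Regular triangulations\<close>

text \<open>Only the double cells of the optimal triangulation are ever exhibited. The heights that
  certify them may have ties elsewhere, so a small perturbation makes them generic while the
  finitely many strict inequalities behind the double cells survive. The cells that complete the
  triangulation stay unknown: the area count turns a lower bound on the number of double cells into
  an upper bound on the total weight. This count is asymmetric. For an arbitrary triangulation it is
  enough that the slices cover the square; for the optimal one their overlaps must have measure
  zero, which comes from the separating functionals of a regular triangulation. The simplex lives in
  an infinite-dimensional space, so regular triangulations are treated by linear algebra on a
  hyperplane \<phi> = 1 of a real vector space without topology.\<close>

lemma eventually_at_right_notin_finite:
  fixes a :: real
  assumes "finite A"
  shows "\<forall>\<^sub>F t in at_right a. t \<notin> A"
  unfolding eventually_at_topological using assms
  by (intro exI[of _ "- (A - {a})"] conjI open_Compl finite_imp_closed) auto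

text \<open>Two different parameters in the set put the direction \<open>y - x\<close> into
  \<open>U\<close>, and then also the point at parameter 1, which is \<open>y\<close>. So at most
  one parameter occurs.\<close>

lemma finite_line_Int_subspace:
  fixes x y :: "'a::real_vector"
  assumes "subspace U" "y \<notin> U"
  shows "finite {t. x + t *\<^sub>R (y - x) \<in> U}"
proof -
  have "t = t'" if t: "x + t *\<^sub>R (y - x) \<in> U" and t': "x + t' *\<^sub>R (y - x) \<in> U" for t t'
  proof (rule ccontr)
    assume "t \<noteq> t'"
    have "(x + t *\<^sub>R (y - x)) - (x + t' *\<^sub>R (y - x)) \<in> U"
      using assms(1) t t' by (rule subspace_diff)
    then have "(t - t') *\<^sub>R (y - x) \<in> U" by (simp add: algebra_simps)
    then have "(1 / (t - t')) *\<^sub>R (t - t') *\<^sub>R (y - x) \<in> U"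
      using assms(1) subspace_scale by blast
    then have d: "y - x \<in> U" using \<open>t \<noteq> t'\<close> by simp
    have "(x + t *\<^sub>R (y - x)) + (1 - t) *\<^sub>R (y - x) \<in> U"
      by (rule subspace_add[OF assms(1) t]) (rule subspace_scale[OF assms(1) d])
    then show False using assms(2) by (simp add: algebra_simps)
  qed
  then have "is_singleton {t. x + t *\<^sub>R (y - x) \<in> U} \<or> {t. x + t *\<^sub>R (y - x) \<in> U} = {}"
    unfolding is_singleton_def by blast
  then show ?thesis by (auto simp: is_singleton_def)
qed

text \<open>Induction on the family: on the segment from a point avoiding the old subspaces to a
  point avoiding the new one, only finitely many parameters are bad.\<close>

lemma convex_avoids_subspaces:
  fixes C :: "'a::real_vector set"
  assumes "finite F" "convex C" "C \<noteq> {}" "\<And>U. U \<in> F \<Longrightarrow> subspace U \<and> \<not> C \<subseteq> U"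
  shows "\<exists>y\<in>C. \<forall>U\<in>F. y \<notin> U"
  using assms(1,4)
proof (induction F rule: finite_induct)
  case empty
  then show ?case using assms(3) by auto
next
  case (insert W F)
  then obtain y where y: "y \<in> C" "\<forall>U\<in>F. y \<notin> U" by auto
  obtain z where z: "z \<in> C" "z \<notin> W" using insert.prems by auto
  have "finite (\<Union>U\<in>F. {t. z + t *\<^sub>R (y - z) \<in> U})"
    using insert y by (auto intro!: finite_line_Int_subspace)
  moreover have "finite {t. y + t *\<^sub>R (z - y) \<in> W}"
    using insert.prems z by (auto intro!: finite_line_Int_subspace)
  \<comment> \<open>Finiteness on a line requires the endpoint at parameter 1 to avoid the subspace.
    For \<open>W\<close> this endpoint is \<open>z\<close>, so the segment is run backwards and the
    parameter is reflected.\<close>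
  then have "finite ((\<lambda>t. 1 - t) ` {t. y + t *\<^sub>R (z - y) \<in> W})" by simp
  ultimately have "infinite ({0..1::real} - (\<Union>U\<in>F. {t. z + t *\<^sub>R (y - z) \<in> U})
      - (\<lambda>t. 1 - t) ` {t. y + t *\<^sub>R (z - y) \<in> W})" (is "infinite ?A")
    by (simp add: Diff_infinite_finite infinite_Icc)
  then have "?A \<noteq> {}" by (rule infinite_imp_nonempty)
  then obtain t where "t \<in> ?A" by blast
  then have t: "0 \<le> t" "t \<le> 1" "\<forall>U\<in>F. z + t *\<^sub>R (y - z) \<notin> U"
      "t \<notin> (\<lambda>t. 1 - t) ` {t. y + t *\<^sub>R (z - y) \<in> W}"
    by simp_all
  have "y + (1 - t) *\<^sub>R (z - y) \<notin> W"
    using t(4) by (auto intro!: image_eqI[of t "\<lambda>t. 1 - t" "1 - t"])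
  moreover have "y + (1 - t) *\<^sub>R (z - y) = z + t *\<^sub>R (y - z)"
    by (simp add: algebra_simps)
  moreover have "z + t *\<^sub>R (y - z) \<in> C"
    using convexD_alt[OF assms(2) z(1) y(1), of t] t by (simp add: algebra_simps)
  ultimately show ?case using t by auto
qed

text \<open>Homogenisation: on the hyperplane \<phi> = 1 affine independence is linear independence,
  affine height functions become linear ones, and a nonnegative combination that yields a point of
  the hull automatically has total mass 1.\<close>

locale homogeneous_points =
  fixes V :: "'a::real_vector set" and \<phi> :: "'a \<Rightarrow> real"
  assumes finite_V: "finite V"
    and linear_\<phi>: "linear \<phi>"
    and \<phi>_1: "v \<in> V \<Longrightarrow> \<phi> v = 1"
begin

abbreviation comb :: "('a \<Rightarrow> real) \<Rightarrow> 'a" where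
  "comb \<alpha> \<equiv> \<Sum>v\<in>V. \<alpha> v *\<^sub>R v"

abbreviation cost :: "('a \<Rightarrow> real) \<Rightarrow> ('a \<Rightarrow> real) \<Rightarrow> real" where
  "cost h \<alpha> \<equiv> \<Sum>v\<in>V. \<alpha> v * h v"

abbreviation support :: "('a \<Rightarrow> real) \<Rightarrow> 'a set" where
  "support \<alpha> \<equiv> {v \<in> V. \<alpha> v \<noteq> 0}"

lemma sum_support:
  assumes "\<And>v. \<alpha> v = 0 \<Longrightarrow> f v = 0"
  shows "sum f V = sum f (support \<alpha>)"
  using finite_V assms by (intro sum.mono_neutral_right) auto

lemma \<phi>_sum:
  assumes "S \<subseteq> V"
  shows "\<phi> (\<Sum>v\<in>S. \<alpha> v *\<^sub>R v) = sum \<alpha> S"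
proof -
  have "\<phi> (\<Sum>v\<in>S. \<alpha> v *\<^sub>R v) = (\<Sum>v\<in>S. \<alpha> v *\<^sub>R \<phi> v)"
    by (simp add: linear_sum[OF linear_\<phi>] linear_cmul[OF linear_\<phi>])
  also have "\<dots> = sum \<alpha> S" using assms \<phi>_1 by (intro sum.cong) auto
  finally show ?thesis .
qed

text \<open>Caratheodory's argument with a cost: as long as the support is dependent, the
  coefficients are moved along a linear relation in the direction that does not raise the cost,
  until the first of them vanishes.\<close>

lemma reduce_support:
  assumes "\<forall>v\<in>V. 0 \<le> \<alpha> v"
  shows "\<exists>\<mu>. (\<forall>v\<in>V. 0 \<le> \<mu> v) \<and> comb \<mu> = comb \<alpha> \<and> independent (support \<mu>) \<and> cost h \<mu> \<le> cost h \<alpha>"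
  using assms
proof (induction "card (support \<alpha>)" arbitrary: \<alpha> rule: less_induct)
  case less
  show ?case
  proof (cases "independent (support \<alpha>)")
    case True
    then show ?thesis using less.prems by blast
  next
    case False
    define S where "S = support \<alpha>"
    have S: "finite S" "S \<subseteq> V" using finite_V by (auto simp: S_def)
    obtain c0 where c0: "\<exists>v\<in>S. c0 v \<noteq> 0" "(\<Sum>v\<in>S. c0 v *\<^sub>R v) = 0"
      using False S dependent_finite[of S] unfolding S_def by auto
    \<comment> \<open>The sign of the relation is chosen so that subtracting a positive multiple of
      it cannot increase the cost.\<close>
    define c where "c = (if (\<Sum>v\<in>S. c0 v * h v) \<ge> 0 then c0 else (\<lambda>v. - c0 v))"
    have c: "\<exists>v\<in>S. c v \<noteq> 0" "(\<Sum>v\<in>S. c v *\<^sub>R v) = 0" "(\<Sum>v\<in>S. c v * h v) \<ge> 0"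
      using c0 by (auto simp: c_def sum_negf)
    \<comment> \<open>Applying \<phi> to the relation shows that its coefficients cancel; hence a
      nontrivial relation has a positive one, which bounds the step length.\<close>
    have "sum c S = 0"
      using \<phi>_sum[OF S(2), of c] c(2) linear_0[OF linear_\<phi>] by simp
    define P where "P = {v\<in>S. c v > 0}"
    have "P \<noteq> {}"
    proof
      assume "P = {}"
      then have "\<forall>v\<in>S. 0 \<le> - c v" by (auto simp: P_def not_less)
      then have "\<forall>v\<in>S. - c v = 0"
        using sum_nonneg_eq_0_iff[OF S(1), of "\<lambda>v. - c v"] \<open>sum c S = 0\<close> by (simp add: sum_negf)
      then show False using c(1) by auto
    qed
    have "finite P" using S by (simp add: P_def)
    \<comment> \<open>The largest step that keeps all coefficients nonnegative; a minimiser of the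
      ratio drops out of the support.\<close>
    define \<epsilon> where "\<epsilon> = Min ((\<lambda>v. \<alpha> v / c v) ` P)"
    have "\<epsilon> \<in> (\<lambda>v. \<alpha> v / c v) ` P" unfolding \<epsilon>_def
      using \<open>P \<noteq> {}\<close> \<open>finite P\<close> by (intro Min_in) auto
    then obtain w where w: "w \<in> S" "c w > 0" "\<epsilon> = \<alpha> w / c w" by (auto simp: P_def)
    have lS: "\<alpha> v > 0" if "v \<in> S" for v
      using that less.prems by (auto simp: S_def order.strict_iff_order)
    have \<epsilon>_pos: "\<epsilon> > 0" using w lS by simp
    have \<epsilon>_le: "\<epsilon> * c v \<le> \<alpha> v" if "v \<in> S" for v
    proof (cases "c v > 0")
      case True
      then have "\<epsilon> \<le> \<alpha> v / c v" unfolding \<epsilon>_def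
        using \<open>finite P\<close> that by (intro Min_le) (auto simp: P_def)
      then show ?thesis using True by (simp add: field_simps)
    next
      case False
      then have "\<epsilon> * c v \<le> 0" using \<epsilon>_pos by (simp add: mult_nonneg_nonpos)
      then show ?thesis using lS[OF that] by linarith
    qed
    define \<mu> where "\<mu> = (\<lambda>v. if v \<in> S then \<alpha> v - \<epsilon> * c v else 0)"
    have \<mu>0: "\<forall>v\<in>V. 0 \<le> \<mu> v" using \<epsilon>_le by (auto simp: \<mu>_def)
    have toS: "(\<Sum>v\<in>V. f v) = (\<Sum>v\<in>S. f v)" if "\<And>v. v \<in> V - S \<Longrightarrow> f v = 0" for f :: "'a \<Rightarrow> 'b::comm_monoid_add"
      using finite_V S that by (intro sum.mono_neutral_right) auto
    have "comb \<mu> = (\<Sum>v\<in>S. (\<alpha> v - \<epsilon> * c v) *\<^sub>R v)"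
      by (subst toS) (auto simp: \<mu>_def)
    also have "\<dots> = (\<Sum>v\<in>S. \<alpha> v *\<^sub>R v) - \<epsilon> *\<^sub>R (\<Sum>v\<in>S. c v *\<^sub>R v)"
      by (simp add: scaleR_sum_right sum_subtractf scaleR_diff_left)
    also have "\<dots> = comb \<alpha>" using c by (subst toS) (auto simp: S_def)
    finally have val: "comb \<mu> = comb \<alpha>" .
    have "cost h \<mu> = (\<Sum>v\<in>S. (\<alpha> v - \<epsilon> * c v) * h v)"
      by (subst toS) (auto simp: \<mu>_def)
    also have "\<dots> = (\<Sum>v\<in>S. \<alpha> v * h v) - \<epsilon> * (\<Sum>v\<in>S. c v * h v)"
      by (simp add: sum_distrib_left sum_subtractf left_diff_distrib mult.assoc)
    also have "(\<Sum>v\<in>S. \<alpha> v * h v) = cost h \<alpha>" by (subst toS) (auto simp: S_def)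
    finally have cst: "cost h \<mu> \<le> cost h \<alpha>" using c(3) \<epsilon>_pos by simp
    have "support \<mu> \<subset> support \<alpha>"
    proof
      show "support \<mu> \<subseteq> support \<alpha>" by (auto simp: \<mu>_def S_def)
      have "\<mu> w = 0" using w by (simp add: \<mu>_def)
      then show "support \<mu> \<noteq> support \<alpha>" using w(1) by (auto simp: S_def)
    qed
    then have "card (support \<mu>) < card (support \<alpha>)"
      using finite_V by (intro psubset_card_mono) auto
    from less.hyps[OF this \<mu>0] show ?thesis using val cst by (metis (no_types, lifting) order_trans)
  qed
qed

text \<open>Spanning is relative to \<open>V\<close>, so the notion makes sense in an
  infinite-dimensional ambient space. For homogeneous points these are the vertex sets of the
  full-dimensional simplices.\<close>

definition is_basis :: "'a set \<Rightarrow> bool" where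
  "is_basis S \<longleftrightarrow> S \<subseteq> V \<and> independent S \<and> V \<subseteq> span S"

lemma is_basisD:
  assumes "is_basis S"
  shows "S \<subseteq> V" "independent S" "V \<subseteq> span S" "finite S"
  using assms finite_V by (auto simp: is_basis_def intro: finite_subset)

lemma ex_is_basis: "\<exists>S. is_basis S"
  using maximal_independent_subset[of V] unfolding is_basis_def by metis

lemma is_basis_card_eq: "is_basis S \<Longrightarrow> is_basis S' \<Longrightarrow> card S = card S'"
  using independent_span_bound[of S S'] independent_span_bound[of S' S]
  by (meson is_basisD order_antisym order_trans)

lemma is_basis_if_spans:
  assumes "is_basis S" "S' \<subseteq> V" "V \<subseteq> span S'" "card S' \<le> card S"
  shows "is_basis S'"
proof -
  obtain B where B: "B \<subseteq> S'" "independent B" "S' \<subseteq> span B"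
    using maximal_independent_subset by metis
  have "V \<subseteq> span B" using B assms(3) by (metis order_trans span_mono span_span)
  then have "is_basis B" using B assms(2) by (auto simp: is_basis_def)
  then have "card B = card S" using assms(1) is_basis_card_eq by blast
  moreover have "finite S'" using assms(2) finite_V finite_subset by blast
  ultimately have "B = S'" using B(1) assms(4) by (simp add: card_seteq)
  then show ?thesis using \<open>is_basis B\<close> by simp
qed

lemma is_basis_if_card:
  assumes "is_basis S" "S' \<subseteq> V" "independent S'" "card S' = card S"
  shows "is_basis S'"
proof -
  have "v \<in> span S'" if "v \<in> V" for v
  proof (rule ccontr)
    assume v: "v \<notin> span S'"
    have "finite S'" using assms(2) finite_V finite_subset by blast
    moreover have "v \<notin> S'" using v span_base by blast
    ultimately have "card (insert v S') = Suc (card S)" using assms(4) by simp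
    moreover have "card (insert v S') \<le> card S"
      using independent_span_bound[of S "insert v S'"] independent_insertI[OF v assms(3)]
        is_basisD[OF assms(1)] assms(2) that by blast
    ultimately show False by simp
  qed
  then show ?thesis using assms by (auto simp: is_basis_def)
qed

text \<open>The simplicial facets of the lower hull of the points lifted by \<open>h\<close>: the
  functional \<open>g\<close> is the supporting hyperplane, which touches the lifted points exactly
  over \<open>S\<close>.\<close>

definition regular_simplices :: "('a \<Rightarrow> real) \<Rightarrow> 'a set set" where
  "regular_simplices h =
     {S. is_basis S \<and> (\<exists>g. linear g \<and> (\<forall>w\<in>S. g w = h w) \<and> (\<forall>v\<in>V - S. g v < h v))}"

text \<open>No hyperplane through a lifted basis contains a further lifted point, so that every
  facet of the lower hull is a simplex.\<close>

definition generic_heights :: "('a \<Rightarrow> real) \<Rightarrow> bool" where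
  "generic_heights h \<longleftrightarrow>
     (\<forall>S g. is_basis S \<longrightarrow> linear g \<longrightarrow> (\<forall>w\<in>S. g w = h w) \<longrightarrow> (\<forall>v\<in>V - S. g v \<noteq> h v))"

definition generic_point :: "'a \<Rightarrow> bool" where
  "generic_point x \<longleftrightarrow> (\<forall>S\<subseteq>V. \<not> V \<subseteq> span S \<longrightarrow> x \<notin> span S)"

lemma finite_regular_simplices: "finite (regular_simplices h)"
  using finite_V by (auto simp: regular_simplices_def is_basis_def intro!: finite_subset[of _ "Pow V"])

lemma mem_convex_hull_V:
  assumes "S \<subseteq> V"
  shows "x \<in> convex hull S \<longleftrightarrow> (\<exists>u. (\<forall>v\<in>S. 0 \<le> u v) \<and> sum u S = 1 \<and> (\<Sum>v\<in>S. u v *\<^sub>R v) = x)"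
  using convex_hull_finite[of S] finite_subset[OF assms finite_V] by simp

lemma \<phi>_hull:
  assumes "x \<in> convex hull V"
  shows "\<phi> x = 1"
proof -
  obtain u where "sum u V = 1" "comb u = x"
    using assms mem_convex_hull_V[of V x] by auto
  then show ?thesis using \<phi>_sum[of V u] by simp
qed

text \<open>Linear programming: among the ways to write \<open>x\<close> as a nonnegative
  combination, one of least cost is taken. Its support is a basis because \<open>x\<close> is
  generic, and the functional that interpolates the heights there is the dual solution. A vertex
  with a height below the functional would allow an improvement.\<close>

lemma generic_point_mem_regular_simplex:
  assumes h: "generic_heights h" and gen: "generic_point x" and x: "x \<in> convex hull V"
  shows "\<exists>S\<in>regular_simplices h. x \<in> convex hull S"
proof -
  define R where "R = {\<alpha>. (\<forall>v\<in>V. 0 \<le> \<alpha> v) \<and> comb \<alpha> = x}"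
  \<comment> \<open>The minimum over the infinite set \<open>R\<close> is reduced to finitely many
    candidates: an independent support carries only one representation of \<open>x\<close>, and
    every representation can be reduced to such a support at no extra cost.\<close>
  define \<S> where "\<S> = {S. independent S \<and> (\<exists>\<alpha>\<in>R. support \<alpha> = S)}"
  have "\<exists>\<alpha>. \<alpha> \<in> R \<and> support \<alpha> = S" if "S \<in> \<S>" for S
    using that by (auto simp: \<S>_def)
  then obtain L where L: "\<And>S. S \<in> \<S> \<Longrightarrow> L S \<in> R \<and> support (L S) = S" by metis
  have "finite \<S>" by (rule finite_subset[of _ "Pow V"]) (use finite_V in \<open>auto simp: \<S>_def\<close>)
  obtain u where "u \<in> R" using x mem_convex_hull_V[of V x] by (auto simp: R_def)
  have unique: "\<alpha> v = \<mu> v"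
    if "\<alpha> \<in> R" "\<mu> \<in> R" "independent S" "support \<alpha> = S" "support \<mu> = S" "v \<in> V" for \<alpha> \<mu> S v
  proof -
    have fin: "finite S" using that(4) finite_V by auto
    have "(\<Sum>w\<in>S. \<alpha> w *\<^sub>R w) = comb \<alpha>" "(\<Sum>w\<in>S. \<mu> w *\<^sub>R w) = comb \<mu>"
      using sum_support[of \<alpha> "\<lambda>w. \<alpha> w *\<^sub>R w"] sum_support[of \<mu> "\<lambda>w. \<mu> w *\<^sub>R w"] that by simp_all
    then have "(\<Sum>w\<in>S. (\<alpha> w - \<mu> w) *\<^sub>R w) = 0"
      using that(1,2) by (simp add: R_def scaleR_diff_left sum_subtractf)
    then have *: "\<forall>w\<in>S. \<alpha> w - \<mu> w = 0"
      using that(3) dependent_finite[OF fin] by (meson)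
    show ?thesis
    proof (cases "v \<in> S")
      case True then show ?thesis using * by simp
    next
      case False
      then have "\<alpha> v = 0" "\<mu> v = 0" using that(4-6) by blast+
      then show ?thesis by simp
    qed
  qed
  have reduce: "\<exists>S\<in>\<S>. cost h (L S) \<le> cost h \<alpha>" if "\<alpha> \<in> R" for \<alpha>
  proof -
    obtain \<mu> where \<mu>: "\<forall>v\<in>V. 0 \<le> \<mu> v" "comb \<mu> = comb \<alpha>" "independent (support \<mu>)" "cost h \<mu> \<le> cost h \<alpha>"
      using reduce_support[of \<alpha> h] \<open>\<alpha> \<in> R\<close> by (auto simp: R_def)
    have "\<mu> \<in> R" using \<mu> that by (simp add: R_def)
    then have S: "support \<mu> \<in> \<S>" using \<mu> by (auto simp: \<S>_def)
    have "\<forall>v\<in>V. L (support \<mu>) v = \<mu> v"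
      using unique[OF _ \<open>\<mu> \<in> R\<close> \<mu>(3), of "L (support \<mu>)"] L[OF S] by blast
    then have "cost h (L (support \<mu>)) = cost h \<mu>" by simp
    then have "cost h (L (support \<mu>)) \<le> cost h \<alpha>" using \<mu>(4) by linarith
    then show ?thesis using S by blast
  qed
  have "\<S> \<noteq> {}" using reduce[OF \<open>u \<in> R\<close>] by auto
  define S where "S = arg_min_on (\<lambda>S. cost h (L S)) \<S>"
  have S: "S \<in> \<S>" unfolding S_def using \<open>finite \<S>\<close> \<open>\<S> \<noteq> {}\<close> by (rule arg_min_if_finite)
  have S_min: "cost h (L S) \<le> cost h (L S')" if "S' \<in> \<S>" for S'
    unfolding S_def using \<open>finite \<S>\<close> \<open>\<S> \<noteq> {}\<close> that by (rule arg_min_least)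
  define \<alpha> where "\<alpha> = L S"
  have \<alpha>: "\<alpha> \<in> R" "support \<alpha> = S" using L[OF S] by (auto simp: \<alpha>_def)
  have opt: "cost h \<alpha> \<le> cost h \<mu>" if "\<mu> \<in> R" for \<mu>
    using reduce[OF that] S_min unfolding \<alpha>_def by (meson order_trans)
  have SV: "S \<subseteq> V" "finite S" and indS: "independent S"
    using \<alpha> S finite_V by (auto simp: \<S>_def)
  have toS: "(\<Sum>v\<in>V. f v) = (\<Sum>v\<in>S. f v)" if "\<And>v. v \<in> V - S \<Longrightarrow> f v = 0" for f :: "'a \<Rightarrow> 'b::comm_monoid_add"
    using finite_V SV that by (intro sum.mono_neutral_right) auto
  have out: "\<alpha> v = 0" if "v \<in> V - S" for v using that \<alpha>(2) by auto
  have xS: "(\<Sum>v\<in>S. \<alpha> v *\<^sub>R v) = x" using \<alpha>(1) out by (subst toS[symmetric]) (auto simp: R_def)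
  then have "x \<in> span S" by (metis (no_types, lifting) span_base span_scale span_sum)
  \<comment> \<open>Here genericity of the point enters: it lies in no span of a set of vertices
    that fails to span everything.\<close>
  then have spanS: "V \<subseteq> span S" using gen SV by (auto simp: generic_point_def)
  then have basis: "is_basis S" using SV indS by (simp add: is_basis_def)
  obtain g where g: "linear g" "\<forall>w\<in>S. g w = h w"
    using linear_independent_extend[OF indS, of h] by auto
  have "g v < h v" if v: "v \<in> V - S" for v
  proof (rule ccontr)
    assume "\<not> g v < h v"
    moreover have "g v \<noteq> h v" using h basis g v by (auto simp: generic_heights_def)
    ultimately have less: "h v < g v" by simp
    have "v \<in> span S" using v spanS by auto
    then obtain c where c: "v = (\<Sum>w\<in>S. c w *\<^sub>R w)" using span_finite[OF SV(2)] by auto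
    have pos: "\<alpha> w > 0" if "w \<in> S" for w
      using that \<alpha> by (force simp: R_def order.strict_iff_order)
    \<comment> \<open>The summand 1 in the denominators keeps them positive when a coefficient
      vanishes, and the inserted 1 keeps the minimum defined when \<open>S\<close> is empty.\<close>
    define \<epsilon> where "\<epsilon> = Min (insert 1 ((\<lambda>w. \<alpha> w / (1 + \<bar>c w\<bar>)) ` S))"
    have "\<epsilon> > 0" unfolding \<epsilon>_def using SV(2) pos
      by (subst Min_gr_iff) (auto intro!: divide_pos_pos simp: add_pos_nonneg)
    have \<epsilon>: "\<epsilon> * c w \<le> \<alpha> w" if "w \<in> S" for w
    proof -
      have "\<epsilon> \<le> \<alpha> w / (1 + \<bar>c w\<bar>)" unfolding \<epsilon>_def using SV(2) that by (intro Min_le) auto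
      then have "\<epsilon> * (1 + \<bar>c w\<bar>) \<le> \<alpha> w"
        by (simp add: pos_le_divide_eq add_pos_nonneg)
      moreover have "\<epsilon> * c w \<le> \<epsilon> * (1 + \<bar>c w\<bar>)"
        using \<open>\<epsilon> > 0\<close> by (intro mult_left_mono) auto
      ultimately show ?thesis by linarith
    qed
    \<comment> \<open>The exchange step: mass \<epsilon> is put on \<open>v\<close>, and the
      expansion of \<open>v\<close> in the basis is removed to the same extent. This changes the
      cost by \<epsilon> times \<open>h v - g v\<close>.\<close>
    define \<mu> where "\<mu> = (\<lambda>w. if w \<in> S then \<alpha> w - \<epsilon> * c w else if w = v then \<epsilon> else 0)"
    have split: "(\<Sum>w\<in>V. f w) = f v + (\<Sum>w\<in>S. f w)" if "\<And>w. w \<in> V - insert v S \<Longrightarrow> f w = 0"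
      for f :: "'a \<Rightarrow> 'b::comm_monoid_add"
    proof -
      have "(\<Sum>w\<in>V. f w) = (\<Sum>w\<in>insert v S. f w)"
        using finite_V SV v that by (intro sum.mono_neutral_right) auto
      then show ?thesis using v SV(2) by simp
    qed
    have vS: "v \<notin> S" using v by simp
    have "comb \<mu> = \<epsilon> *\<^sub>R v + (\<Sum>w\<in>S. (\<alpha> w - \<epsilon> * c w) *\<^sub>R w)"
      using vS by (subst split) (auto simp: \<mu>_def)
    also have "(\<Sum>w\<in>S. (\<alpha> w - \<epsilon> * c w) *\<^sub>R w) = x - \<epsilon> *\<^sub>R v"
      by (simp add: xS[symmetric] scaleR_diff_left sum_subtractf)
        (subst c, simp add: scaleR_sum_right)
    finally have "comb \<mu> = x" by simp
    then have "\<mu> \<in> R" using \<epsilon> \<open>\<epsilon> > 0\<close> by (auto simp: R_def \<mu>_def)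
    then have le: "cost h \<alpha> \<le> cost h \<mu>" by (rule opt)
    have "g v = (\<Sum>w\<in>S. c w * h w)"
      using g by (subst c) (simp add: linear_sum linear_cmul)
    have "cost h \<mu> = \<epsilon> * h v + (\<Sum>w\<in>S. (\<alpha> w - \<epsilon> * c w) * h w)"
      using vS by (subst split) (auto simp: \<mu>_def)
    also have "(\<Sum>w\<in>S. (\<alpha> w - \<epsilon> * c w) * h w) = (\<Sum>w\<in>S. \<alpha> w * h w) - \<epsilon> * g v"
      by (simp add: \<open>g v = _\<close> left_diff_distrib sum_subtractf sum_distrib_left mult.assoc)
    also have "(\<Sum>w\<in>S. \<alpha> w * h w) = cost h \<alpha>" using out by (subst toS) auto
    finally have "cost h \<mu> = cost h \<alpha> - \<epsilon> * (g v - h v)" by (simp add: algebra_simps)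
    moreover have "\<epsilon> * (g v - h v) > 0" using \<open>\<epsilon> > 0\<close> less by simp
    ultimately show False using le by linarith
  qed
  then have "S \<in> regular_simplices h" using basis g by (auto simp: regular_simplices_def)
  moreover have "x \<in> convex hull S"
  proof -
    have "sum \<alpha> V = \<phi> (comb \<alpha>)" by (rule \<phi>_sum[symmetric]) simp
    also have "\<dots> = \<phi> x" using \<alpha> by (simp add: R_def)
    also have "\<dots> = 1" using x by (rule \<phi>_hull)
    finally have "sum \<alpha> S = 1" using out by (subst toS[symmetric]) auto
    then show ?thesis using xS \<alpha> SV by (auto simp: mem_convex_hull_V R_def)
  qed
  ultimately show ?thesis by blast
qed

lemma ex_generic_point:
  assumes "V \<noteq> {}"
  shows "\<exists>y\<in>convex hull V. generic_point y"
proof -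
  have "\<exists>y\<in>convex hull V. \<forall>U\<in>span ` {S \<in> Pow V. \<not> V \<subseteq> span S}. y \<notin> U"
  proof (rule convex_avoids_subspaces)
    fix U assume "U \<in> span ` {S \<in> Pow V. \<not> V \<subseteq> span S}"
    then show "subspace U \<and> \<not> convex hull V \<subseteq> U"
      using hull_subset[of V convex] by auto
  qed (use finite_V assms in auto)
  then show ?thesis by (auto simp: generic_point_def)
qed

text \<open>An arbitrary point is approached by generic points on the segment towards a fixed
  generic point. Finitely many simplices are available, so one of them contains such points
  arbitrarily close to \<open>x\<close>, and it then contains \<open>x\<close> as well.\<close>

lemma regular_simplices_cover:
  assumes h: "generic_heights h" and x: "x \<in> convex hull V"
  shows "\<exists>S\<in>regular_simplices h. x \<in> convex hull S"
proof -
  have "V \<noteq> {}" using x by auto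
  then obtain y where y: "y \<in> convex hull V" "generic_point y" using ex_generic_point by auto
  define z where "z t = x + t *\<^sub>R (y - x)" for t
  define bad where "bad = (\<Union>S\<in>{S \<in> Pow V. \<not> V \<subseteq> span S}. {t. z t \<in> span S})"
  have "finite bad" unfolding bad_def z_def
    using finite_V y(2) by (auto simp: generic_point_def intro!: finite_line_Int_subspace)
  have good: "\<exists>S\<in>regular_simplices h. z t \<in> convex hull S" if "0 < t" "t < 1" "t \<notin> bad" for t
  proof (rule generic_point_mem_regular_simplex[OF h])
    show "generic_point (z t)" using that(3) by (auto simp: generic_point_def bad_def)
    show "z t \<in> convex hull V"
      using convexD_alt[OF convex_convex_hull x y(1), of t] that
      by (simp add: z_def algebra_simps)
  qed
  have "\<forall>\<^sub>F t in at_right 0. t \<notin> bad"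
    using \<open>finite bad\<close> by (rule eventually_at_right_notin_finite)
  moreover have "\<forall>\<^sub>F t in at_right 0. 0 < t \<and> t < (1::real)"
    by (auto simp: eventually_at_right_field intro: exI[of _ 1])
  ultimately have "\<forall>\<^sub>F t in at_right 0. \<exists>S\<in>regular_simplices h. z t \<in> convex hull S"
    by eventually_elim (use good in auto)
  then have "\<exists>\<^sub>F t in at_right 0. \<exists>S\<in>regular_simplices h. z t \<in> convex hull S"
    by (simp add: eventually_frequently)
  then obtain S where S: "S \<in> regular_simplices h" "\<exists>\<^sub>F t in at_right 0. z t \<in> convex hull S"
    by (auto simp: frequently_bex_finite_distrib finite_regular_simplices)
  have bS: "is_basis S" using S by (simp add: regular_simplices_def)
  note bS' = is_basisD[OF bS]
  have xV: "x \<in> span V" using x convex_hull_subset_span by blast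
  then have "x \<in> span S" using bS'(3) by (metis span_mono span_span subsetD)
  then obtain c where c: "x = (\<Sum>w\<in>S. c w *\<^sub>R w)" using span_finite[OF bS'(4)] by auto
  have "c w \<ge> 0" if w: "w \<in> S" for w
  proof (rule ccontr)
    assume "\<not> c w \<ge> 0"
    \<comment> \<open>The coordinate of \<open>w\<close> in the basis \<open>S\<close>. It stands in
      for closedness of the simplex: if it were negative at \<open>x\<close>, it would be negative
      at all nearby points of the segment too.\<close>
    obtain f :: "'a \<Rightarrow> real" where f: "linear f" "\<forall>v\<in>S. f v = (if v = w then 1 else 0)"
      using linear_independent_extend[OF bS'(2), of "\<lambda>v. if v = w then 1 else 0"] by auto
    have fz: "f (z t) = f x + t * f (y - x)" for t
      by (simp add: z_def linear_add[OF f(1)] linear_cmul[OF f(1)])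
    have "f x = (\<Sum>v\<in>S. c v * f v)" by (subst c) (simp add: linear_sum[OF f(1)] linear_cmul[OF f(1)])
    also have "\<dots> = (\<Sum>v\<in>S. if v = w then c v else 0)" using f(2) by (intro sum.cong) auto
    also have "\<dots> = c w" using w bS'(4) by simp
    finally have "f x < 0" using \<open>\<not> c w \<ge> 0\<close> by simp
    have "((\<lambda>t. f x + t * f (y - x)) \<longlongrightarrow> f x + 0 * f (y - x)) (at_right 0)"
      by (intro tendsto_intros)
    then have "\<forall>\<^sub>F t in at_right 0. f (z t) < 0"
      using \<open>f x < 0\<close> by (auto simp: fz dest: order_tendstoD(2))
    moreover have "convex hull S \<subseteq> f -` {0..}"
      using f by (intro hull_minimal convex_linear_vimage) auto
    ultimately have "\<forall>\<^sub>F t in at_right 0. z t \<notin> convex hull S"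
      by (auto elim!: eventually_mono)
    then show False using S(2) by (simp add: frequently_def)
  qed
  moreover have "sum c S = 1"
    using \<phi>_sum[OF bS'(1), of c] \<phi>_hull[OF x] c by simp
  ultimately have "x \<in> convex hull S" using c mem_convex_hull_V[OF bS'(1)] by auto
  then show ?thesis using S by blast
qed

text \<open>The separating functional is the difference of the two supporting functionals: on the
  first simplex the one equals the height and the other is at most the height, strictly away from
  the second simplex.\<close>

lemma regular_simplices_separated:
  assumes \<sigma>: "\<sigma> \<in> regular_simplices h" and \<tau>: "\<tau> \<in> regular_simplices h"
  shows "\<exists>f. linear f \<and> (\<forall>x\<in>convex hull \<sigma>. 0 \<le> f x) \<and> (\<forall>x\<in>convex hull \<tau>. f x \<le> (0::real)) \<and>
    (\<forall>v\<in>\<sigma> - \<tau>. 0 < f v) \<and> (\<forall>v\<in>\<tau> - \<sigma>. f v < 0)"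
proof -
  obtain g where g: "linear g" "\<forall>w\<in>\<sigma>. g w = h w" "\<forall>v\<in>V - \<sigma>. g v < h v"
    using \<sigma> by (auto simp: regular_simplices_def)
  obtain g' where g': "linear g'" "\<forall>w\<in>\<tau>. g' w = h w" "\<forall>v\<in>V - \<tau>. g' v < h v"
    using \<tau> by (auto simp: regular_simplices_def)
  have \<sigma>V: "\<sigma> \<subseteq> V" and \<tau>V: "\<tau> \<subseteq> V"
    using \<sigma> \<tau> by (auto simp: regular_simplices_def is_basis_def)
  define f where "f x = g x - g' x" for x
  have f: "linear f" unfolding f_def using g g' by (intro linear_compose_sub)
  have "f w \<ge> 0" if "w \<in> \<sigma>" for w
    using that g g' \<sigma>V by (cases "w \<in> \<tau>") (auto simp: f_def less_imp_le)
  then have "f x \<ge> 0" if "x \<in> convex hull \<sigma>" for x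
    using hull_minimal[of \<sigma> "f -` {0..}" convex] convex_linear_vimage[OF f] that by auto
  moreover have "f w \<le> 0" if "w \<in> \<tau>" for w
    using that g g' \<tau>V by (cases "w \<in> \<sigma>") (auto simp: f_def less_imp_le)
  then have "f x \<le> 0" if "x \<in> convex hull \<tau>" for x
    using hull_minimal[of \<tau> "f -` {..0}" convex] convex_linear_vimage[OF f] that by auto
  moreover have "f v > 0" if "v \<in> \<sigma> - \<tau>" for v
    using that g g' \<sigma>V by (auto simp: f_def)
  moreover have "f v < 0" if "v \<in> \<tau> - \<sigma>" for v
    using that g g' \<tau>V by (auto simp: f_def)
  ultimately show ?thesis using f by blast
qed

text \<open>On the hull of \<sigma> the separating functional is nonnegative and vanishes only when
  all mass lies on \<sigma> \<inter> \<tau>. So the intersection is its zero set, and the zero set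
  of a nonnegative linear functional is a face.\<close>

lemma regular_simplices_face:
  assumes \<sigma>: "\<sigma> \<in> regular_simplices h" and \<tau>: "\<tau> \<in> regular_simplices h"
  shows "(convex hull \<sigma> \<inter> convex hull \<tau>) face_of (convex hull \<sigma>)"
proof -
  obtain f :: "'a \<Rightarrow> real" where f: "linear f" and pos: "\<And>x. x \<in> convex hull \<sigma> \<Longrightarrow> 0 \<le> f x"
    and neg: "\<And>x. x \<in> convex hull \<tau> \<Longrightarrow> f x \<le> 0" and f_pos: "\<And>v. v \<in> \<sigma> - \<tau> \<Longrightarrow> 0 < f v"
    using regular_simplices_separated[OF \<sigma> \<tau>] by blast
  have \<sigma>V: "\<sigma> \<subseteq> V" using \<sigma> by (auto simp: regular_simplices_def is_basis_def)
  have fin: "finite \<sigma>" using \<sigma>V finite_V finite_subset by blast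
  have "x \<in> convex hull \<tau>" if x: "x \<in> convex hull \<sigma>" "f x = 0" for x
  proof -
    obtain u where u: "\<forall>v\<in>\<sigma>. 0 \<le> u v" "sum u \<sigma> = 1" "(\<Sum>v\<in>\<sigma>. u v *\<^sub>R v) = x"
      using x(1) mem_convex_hull_V[OF \<sigma>V] by auto
    have "(\<Sum>v\<in>\<sigma>. u v * f v) = 0"
      using x(2) u(3) by (auto simp: linear_sum[OF f] linear_cmul[OF f])
    then have "\<forall>v\<in>\<sigma>. u v * f v = 0"
      using u(1) pos[OF hull_inc] fin by (subst (asm) sum_nonneg_eq_0_iff) auto
    then have z: "u v = 0" if "v \<in> \<sigma> - \<tau>" for v
      using that f_pos[OF that] by auto
    have "sum u (\<sigma> \<inter> \<tau>) = 1" "(\<Sum>v\<in>\<sigma> \<inter> \<tau>. u v *\<^sub>R v) = x"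
      using u(2,3) z sum.mono_neutral_left[OF fin, of "\<sigma> \<inter> \<tau>" u]
        sum.mono_neutral_left[OF fin, of "\<sigma> \<inter> \<tau>" "\<lambda>v. u v *\<^sub>R v"] by auto
    then have "x \<in> convex hull (\<sigma> \<inter> \<tau>)"
      using u(1) \<sigma>V by (subst mem_convex_hull_V) auto
    then show ?thesis using hull_mono[of "\<sigma> \<inter> \<tau>" \<tau> convex] by auto
  qed
  then have eq: "convex hull \<sigma> \<inter> convex hull \<tau> = {x \<in> convex hull \<sigma>. f x = 0}"
    using pos neg by (auto intro: order_antisym)
  show ?thesis
    unfolding face_of_def
  proof (intro conjI ballI impI)
    show "convex (convex hull \<sigma> \<inter> convex hull \<tau>)" by (simp add: convex_Int)
    fix a b x
    assume a: "a \<in> convex hull \<sigma>" and b: "b \<in> convex hull \<sigma>"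
      and x: "x \<in> convex hull \<sigma> \<inter> convex hull \<tau>" "x \<in> open_segment a b"
    obtain t where t: "0 < t" "t < 1" "x = (1 - t) *\<^sub>R a + t *\<^sub>R b"
      using x(2) by (auto simp: in_segment)
    have "(1 - t) * f a + t * f b = 0"
      using x(1) eq by (auto simp: t(3) linear_add[OF f] linear_cmul[OF f])
    moreover have "(1 - t) * f a \<ge> 0" "t * f b \<ge> 0" using t pos a b by auto
    ultimately have "(1 - t) * f a = 0" "t * f b = 0" by linarith+
    then have "f a = 0" "f b = 0" using t by auto
    then show "a \<in> convex hull \<sigma> \<inter> convex hull \<tau>" "b \<in> convex hull \<sigma> \<inter> convex hull \<tau>"
      using eq a b by auto
  qed blast
qed

lemma affine_dependent_iff_dependent:
  assumes "S \<subseteq> V"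
  shows "affine_dependent S \<longleftrightarrow> dependent S"
proof -
  have fin: "finite S" using assms finite_V finite_subset by blast
  have "sum u S = 0" if "(\<Sum>v\<in>S. u v *\<^sub>R v) = 0" for u
    using \<phi>_sum[OF assms, of u] that linear_0[OF linear_\<phi>] by simp
  then show ?thesis
    unfolding affine_dependent_explicit_finite[OF fin] dependent_finite[OF fin] by metis
qed

section \<open>Perturbation to generic heights\<close>

definition perturbed :: "('a \<Rightarrow> real) \<Rightarrow> ('a \<Rightarrow> nat) \<Rightarrow> real \<Rightarrow> 'a \<Rightarrow> real" where
  "perturbed h e t v = h v + t ^ e v"

text \<open>
  A height coincidence is the vanishing of a polynomial in \<open>t\<close> that contains the monomial \<open>t ^ e v\<close>
  with coefficient \<open>1\<close>, so it happens for finitely many \<open>t\<close> only.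
\<close>

lemma eventually_generic_heights:
  assumes e: "inj_on e V" "\<And>v. v \<in> V \<Longrightarrow> 0 < e v"
  shows "\<forall>\<^sub>F t in at_right 0. generic_heights (perturbed h e t)"
proof -
  define \<B> where "\<B> = {(S, v). is_basis S \<and> v \<in> V - S}"
  have "finite \<B>"
    by (rule finite_subset[of _ "Pow V \<times> V"]) (use finite_V in \<open>auto simp: \<B>_def is_basis_def\<close>)
  have *: "\<forall>\<^sub>F t in at_right 0. \<forall>g. linear g \<longrightarrow> (\<forall>w\<in>S. g w = perturbed h e t w) \<longrightarrow> g v \<noteq> perturbed h e t v"
    if S: "is_basis S" and v: "v \<in> V - S" for S v
  proof -
    note S' = is_basisD[OF S]
    obtain c where c: "v = (\<Sum>w\<in>S. c w *\<^sub>R w)"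
      using v S'(3) span_finite[OF S'(4)] by auto
    define p where "p = [:h v - (\<Sum>w\<in>S. c w * h w):] + monom 1 (e v) - (\<Sum>w\<in>S. monom (c w) (e w))"
    have "coeff (\<Sum>w\<in>S. monom (c w) (e w)) (e v) = (\<Sum>w\<in>S. 0)"
      unfolding coeff_sum using e(1) v S'(1) by (intro sum.cong) (auto dest: inj_onD)
    \<comment> \<open>A positive exponent keeps the constant term of \<open>p\<close> away from this
      coefficient; the monomials from \<open>S\<close> miss it by injectivity of
      \<open>e\<close>.\<close>
    moreover have "0 < e v" using v e(2) by blast
    ultimately have "coeff p (e v) = 1"
      by (cases "e v") (auto simp: p_def)
    then have "p \<noteq> 0" by auto
    then have "\<forall>\<^sub>F t in at_right 0. t \<notin> {t. poly p t = 0}"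
      by (intro eventually_at_right_notin_finite poly_roots_finite)
    then show ?thesis
    proof eventually_elim
      case (elim t)
      show ?case
      proof (intro allI impI notI)
        fix g :: "'a \<Rightarrow> real"
        assume g: "linear g" "\<forall>w\<in>S. g w = perturbed h e t w" "g v = perturbed h e t v"
        have "g v = (\<Sum>w\<in>S. c w * perturbed h e t w)"
          using g(2) by (subst c) (simp add: linear_sum[OF g(1)] linear_cmul[OF g(1)])
        then have "poly p t = 0"
          using g(3) by (simp add: p_def perturbed_def poly_monom poly_sum algebra_simps sum.distrib)
        then show False using elim by simp
      qed
    qed
  qed
  have "\<forall>\<^sub>F t in at_right 0. \<forall>b\<in>\<B>. \<forall>g. linear g \<longrightarrow>
      (\<forall>w\<in>fst b. g w = perturbed h e t w) \<longrightarrow> g (snd b) \<noteq> perturbed h e t (snd b)"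
    using \<open>finite \<B>\<close> * by (intro eventually_ball_finite) (auto simp: \<B>_def)
  then show ?thesis
    by eventually_elim (auto simp: generic_heights_def \<B>_def)
qed

text \<open>The value at \<open>v\<close> of the functional interpolating the heights on
  \<open>S\<close> is a fixed linear combination of those heights. It therefore depends continuously
  on \<open>t\<close>, and the strict inequality at \<open>t = 0\<close> persists.\<close>

lemma eventually_mem_regular_simplices:
  assumes S: "S \<in> regular_simplices h" and e: "\<And>v. v \<in> V \<Longrightarrow> 0 < e v"
  shows "\<forall>\<^sub>F t in at_right 0. S \<in> regular_simplices (perturbed h e t)"
proof -
  obtain g where g: "linear g" "\<forall>w\<in>S. g w = h w" "\<forall>v\<in>V - S. g v < h v" and bS: "is_basis S"
    using S by (auto simp: regular_simplices_def)
  note S' = is_basisD[OF bS]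
  have *: "\<forall>\<^sub>F t in at_right 0. \<forall>g. linear g \<longrightarrow> (\<forall>w\<in>S. g w = perturbed h e t w) \<longrightarrow> g v < perturbed h e t v"
    if v: "v \<in> V - S" for v
  proof -
    obtain c where c: "v = (\<Sum>w\<in>S. c w *\<^sub>R w)"
      using v S'(3) span_finite[OF S'(4)] by auto
    have lim: "((\<lambda>t. perturbed h e t w) \<longlongrightarrow> h w) (at_right 0)" if "w \<in> V" for w
    proof -
      have "((\<lambda>t. h w + t ^ e w) \<longlongrightarrow> h w + 0 ^ e w) (at_right (0::real))" by (intro tendsto_intros)
      then show ?thesis using e[OF that] by (simp add: perturbed_def zero_power)
    qed
    have "((\<lambda>t. (\<Sum>w\<in>S. c w * perturbed h e t w)) \<longlongrightarrow> (\<Sum>w\<in>S. c w * h w)) (at_right 0)"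
      using S'(1) by (intro tendsto_intros lim) auto
    moreover have "(\<Sum>w\<in>S. c w * h w) = g v"
      using g by (subst c) (simp add: linear_sum[OF g(1)] linear_cmul[OF g(1)])
    ultimately have "((\<lambda>t. perturbed h e t v - (\<Sum>w\<in>S. c w * perturbed h e t w)) \<longlongrightarrow> h v - g v) (at_right 0)"
      using v by (intro tendsto_diff lim) auto
    then have "\<forall>\<^sub>F t in at_right 0. perturbed h e t v - (\<Sum>w\<in>S. c w * perturbed h e t w) > 0"
      using g(3) v by (intro order_tendstoD) auto
    then show ?thesis
    proof eventually_elim
      case (elim t)
      show ?case
      proof (intro allI impI)
        fix g' :: "'a \<Rightarrow> real"
        assume g': "linear g'" "\<forall>w\<in>S. g' w = perturbed h e t w"
        have "g' v = (\<Sum>w\<in>S. c w * perturbed h e t w)"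
          using g'(2) by (subst c) (simp add: linear_sum[OF g'(1)] linear_cmul[OF g'(1)])
        then show "g' v < perturbed h e t v" using elim by simp
      qed
    qed
  qed
  have "\<forall>\<^sub>F t in at_right 0. \<forall>v\<in>V - S. \<forall>g. linear g \<longrightarrow>
      (\<forall>w\<in>S. g w = perturbed h e t w) \<longrightarrow> g v < perturbed h e t v"
    using finite_V * by (intro eventually_ball_finite) auto
  then show ?thesis
  proof eventually_elim
    case (elim t)
    obtain g' where "linear g'" "\<forall>w\<in>S. g' w = perturbed h e t w"
      using linear_independent_extend[OF S'(2), of "perturbed h e t"] by auto
    then show ?case using elim bS by (auto simp: regular_simplices_def)
  qed
qed

end

section \<open>Vertices of the product\<close>

lemma lookup_scaleR [simp]: "Poly_Mapping.lookup (r *\<^sub>R f) k = r *\<^sub>R Poly_Mapping.lookup f k"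
proof -
  have "{i. r *\<^sub>R Poly_Mapping.lookup f i \<noteq> 0} \<subseteq> {i. Poly_Mapping.lookup f i \<noteq> 0}" by auto
  then have "finite {i. r *\<^sub>R Poly_Mapping.lookup f i \<noteq> 0}"
    using finite_lookup finite_subset by blast
  then show ?thesis by (simp add: scaleR_poly_mapping_def Abs_poly_mapping_inverse)
qed

type_synonym point = "(real \<times> real) \<times> (nat \<Rightarrow>\<^sub>0 real)"

definition coord :: "nat \<Rightarrow> point \<Rightarrow> real" where
  "coord k x = Poly_Mapping.lookup (snd x) k"

definition xpos :: "point \<Rightarrow> real" where "xpos x = fst (fst x)"

definition ypos :: "point \<Rightarrow> real" where "ypos x = snd (fst x)"

lemma linear_coord: "linear (coord k)"
  by (rule linearI) (auto simp: coord_def lookup_add)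

lemma linear_xpos: "linear xpos" and linear_ypos: "linear ypos"
  by (auto intro!: linearI simp: xpos_def ypos_def)

lemma point_eqI:
  assumes "xpos x = xpos y" "ypos x = ypos y" "\<And>k. coord k x = coord k y"
  shows "x = y"
  using assms by (auto simp: xpos_def ypos_def coord_def prod_eq_iff poly_mapping_eqI)

definition corners :: "(real \<times> real) set" where
  "corners = {0, 1} \<times> {0, 1}"

definition vertex :: "real \<times> real \<Rightarrow> nat \<Rightarrow> point" where
  "vertex c k = (c, simplex_vertex k)"

definition vertices :: "nat \<Rightarrow> point set" where
  "vertices m = corners \<times> simplex_vertex ` {1..m}"

lemma coord_vertex [simp]: "coord k (vertex c i) = (if k = i then 1 else 0)"
  by (simp add: coord_def vertex_def simplex_vertex_def lookup_single)

lemma xpos_vertex [simp]: "xpos (vertex c k) = fst c" and ypos_vertex [simp]: "ypos (vertex c k) = snd c"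
  by (auto simp: xpos_def ypos_def vertex_def)

lemma vertex_eq_iff [simp]: "vertex c i = vertex d j \<longleftrightarrow> c = d \<and> i = j"
  by (metis coord_vertex vertex_def prod.inject zero_neq_one)

lemma vertices_eq: "vertices m = (\<lambda>(c, k). vertex c k) ` (corners \<times> {1..m})"
  by (auto simp: vertices_def vertex_def)

lemma mem_vertices_iff: "v \<in> vertices m \<longleftrightarrow> (\<exists>c\<in>corners. \<exists>k\<in>{1..m}. v = vertex c k)"
  by (auto simp: vertices_eq)

lemma vertex_mem_vertices [simp]: "vertex c k \<in> vertices m \<longleftrightarrow> c \<in> corners \<and> k \<in> {1..m}"
  by (auto simp: mem_vertices_iff)

lemma mem_part_iff:
  assumes "S \<subseteq> vertices m"
  shows "v \<in> part S k \<longleftrightarrow> v \<in> S \<and> (\<exists>c\<in>corners. v = vertex c k)"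
  using assms by (fastforce simp: part_def mem_vertices_iff vertex_def corners_def square_def)

lemma linear_total: "linear (\<lambda>x. \<Sum>k=1..m. coord k x)"
  by (intro linear_compose_sum ballI linear_coord)

lemma total_vertex: "v \<in> vertices m \<Longrightarrow> (\<Sum>k=1..m. coord k v) = 1"
  by (auto simp: mem_vertices_iff)

text \<open>The barycentric coordinates of the simplex factor sum to 1 on all vertices, so their sum
  serves as the homogenising functional.\<close>

interpretation hp: homogeneous_points "vertices m" "\<lambda>x. \<Sum>k=1..m. coord k x" for m
proof (rule homogeneous_points.intro)
  show "finite (vertices m)" by (simp add: vertices_def corners_def)
qed (rule linear_total, rule total_vertex)

lemma convex_hull_01: "convex hull {0, 1::real} = {0..1}"
  by (metis closed_segment_eq_real_ivl segment_convex_hull zero_le_one)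

lemma convex_hull_vertices: "convex hull vertices m = square_times_simplex m"
  by (simp only: vertices_def corners_def square_times_simplex_def square_def std_simplex_def
      convex_hull_Times convex_hull_01)

text \<open>A convex combination that attains the maximum puts all its mass on \<open>v\<close>. If
  \<open>v\<close> were inside a segment of the hull, both endpoints would attain the maximum and
  coincide with \<open>v\<close>.\<close>

lemma extreme_point_if_unique_max:
  fixes f :: "'a::real_vector \<Rightarrow> real"
  assumes "finite S" "v \<in> S" "linear f" and max: "\<And>w. w \<in> S \<Longrightarrow> w \<noteq> v \<Longrightarrow> f w < f v"
  shows "v extreme_point_of convex hull S"
proof -
  have leS: "f w \<le> f v" if "w \<in> S" for w
  proof (cases "w = v")
    case False
    then show ?thesis using max[OF that] by simp
  qed simp
  have "convex hull S \<subseteq> f -` {..f v}"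
  proof (rule hull_minimal)
    show "S \<subseteq> f -` {..f v}" using leS by blast
    show "convex (f -` {..f v})" by (rule convex_linear_vimage[OF assms(3)]) simp
  qed
  then have le: "f x \<le> f v" if "x \<in> convex hull S" for x
    using that by blast
  have eq: "x = v" if x: "x \<in> convex hull S" "f x = f v" for x
  proof -
    obtain u where u: "\<forall>w\<in>S. 0 \<le> u w" "sum u S = 1" "(\<Sum>w\<in>S. u w *\<^sub>R w) = x"
      using x(1) convex_hull_finite[OF assms(1)] by auto
    have "f x = (\<Sum>w\<in>S. u w * f w)"
      by (simp add: u(3)[symmetric] linear_sum[OF assms(3)] linear_cmul[OF assms(3)])
    then have "(\<Sum>w\<in>S. u w * (f v - f w)) = 0"
      using that(2) u(2) by (simp add: right_diff_distrib sum_subtractf sum_distrib_right[symmetric])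
    moreover have "0 \<le> u w * (f v - f w)" if "w \<in> S" for w
      using u(1) max that by (cases "w = v") (auto simp: less_imp_le)
    ultimately have z: "\<forall>w\<in>S. u w * (f v - f w) = 0"
      by (subst (asm) sum_nonneg_eq_0_iff[OF assms(1)]) auto
    have "u w = 0" if "w \<in> S - {v}" for w
      using z max[of w] that by auto
    then have "(\<Sum>w\<in>S. u w *\<^sub>R w) = (\<Sum>w\<in>{v}. u w *\<^sub>R w)" "sum u S = sum u {v}"
      using assms(1,2) by (intro sum.mono_neutral_right; auto)+
    then show ?thesis using u by simp
  qed
  have "v \<in> convex hull S" using assms(2) by (simp add: hull_inc)
  moreover have "v \<notin> open_segment a b" if ab: "a \<in> convex hull S" "b \<in> convex hull S" for a b
  proof
    assume v: "v \<in> open_segment a b"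
    then obtain t where t: "0 < t" "t < 1" "v = (1 - t) *\<^sub>R a + t *\<^sub>R b" by (auto simp: in_segment)
    have e: "f v = (1 - t) * f a + t * f b"
      by (subst t(3)) (simp add: linear_add[OF assms(3)] linear_cmul[OF assms(3)])
    then have "(1 - t) * (f v - f a) + t * (f v - f b) = 0" by (simp add: algebra_simps)
    moreover have "0 \<le> (1 - t) * (f v - f a)" "0 \<le> t * (f v - f b)" using t le ab by auto
    ultimately have "(1 - t) * (f v - f a) = 0" "t * (f v - f b) = 0" by linarith+
    then have "f a = f v" "f b = f v" using t by auto
    then have "a = b" using eq ab by metis
    then show False using v by simp
  qed
  ultimately show ?thesis by (auto simp: extreme_point_of_def)
qed

lemma extreme_points_square_times_simplex: "{v. v extreme_point_of square_times_simplex m} = vertices m"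
proof -
  have "v extreme_point_of convex hull vertices m" if v: "v \<in> vertices m" for v
  proof -
    obtain c k where ck: "c \<in> corners" "k \<in> {1..m}" "v = vertex c k" using v by (auto simp: mem_vertices_iff)
    \<comment> \<open>The factors \<open>2 * fst c - 1\<close> and \<open>2 * snd c - 1\<close> are
      signs that make \<open>c\<close> the unique best corner, and the last summand rewards the
      level \<open>k\<close>.\<close>
    define f where "f x = (2 * fst c - 1) * xpos x + (2 * snd c - 1) * ypos x + coord k x" for x
    have "linear f" unfolding f_def
      by (rule linearI)
        (simp_all add: linear_add[OF linear_coord] linear_add[OF linear_xpos] linear_add[OF linear_ypos]
          linear_cmul[OF linear_coord] linear_cmul[OF linear_xpos] linear_cmul[OF linear_ypos] algebra_simps)
    moreover have "f w < f v" if "w \<in> vertices m" "w \<noteq> v" for w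
      using that ck by (auto simp: mem_vertices_iff f_def corners_def)
    ultimately show ?thesis using hp.finite_V v by (intro extreme_point_if_unique_max) auto
  qed
  then show ?thesis using extreme_point_of_convex_hull by (auto simp: convex_hull_vertices[symmetric])
qed

lemma notin_span_if_kernel: "linear f \<Longrightarrow> \<forall>x\<in>S. f x = 0 \<Longrightarrow> f x \<noteq> 0 \<Longrightarrow> x \<notin> span S"
  by (metis linear_eq_0_on_span)

lemma independent_bottom: "independent ((\<lambda>k. vertex (0, 0) k) ` {1..m})"
proof (induction m)
  case (Suc m)
  have "vertex (0, 0) (Suc m) \<notin> span ((\<lambda>k. vertex (0, 0) k) ` {1..m})"
    by (rule notin_span_if_kernel[OF linear_coord[of "Suc m"]]) (simp_all add: image_iff)
  then show ?case using Suc by (simp add: atLeastAtMostSuc_conv independent_insertI)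
qed (simp add: independent_empty)

text \<open>One explicit basis fixes the size of all of them: the corner (0, 0) on every level,
  together with two neighbouring corners on the first level that supply the horizontal and the
  vertical direction.\<close>

lemma ex_basis_vertices:
  assumes "m \<ge> 1"
  shows "\<exists>B. hp.is_basis m B \<and> card B = m + 2"
proof -
  define E where "E = (\<lambda>k. vertex (0, 0) k) ` {1..m}"
  define B where "B = insert (vertex (0, 1) 1) (insert (vertex (1, 0) 1) E)"
  have "vertex (1, 0) 1 \<notin> span E"
    by (rule notin_span_if_kernel[OF linear_xpos]) (simp_all add: E_def)
  moreover have "vertex (0, 1) 1 \<notin> span (insert (vertex (1, 0) 1) E)"
    by (rule notin_span_if_kernel[OF linear_ypos]) (simp_all add: E_def)
  ultimately have "independent B"
    unfolding B_def by (intro independent_insertI) (simp_all add: E_def independent_bottom[simplified])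
  moreover have "vertices m \<subseteq> span B"
  proof
    fix v assume "v \<in> vertices m"
    then obtain a b k where v: "k \<in> {1..m}" "v = vertex (a, b) k" by (auto simp: mem_vertices_iff)
    have "v = vertex (0, 0) k + a *\<^sub>R (vertex (1, 0) 1 - vertex (0, 0) 1) + b *\<^sub>R (vertex (0, 1) 1 - vertex (0, 0) 1)"
      by (simp add: v(2) vertex_def)
    also have "\<dots> \<in> span B"
      using v(1) assms by (intro span_add span_scale span_diff span_base) (auto simp: B_def E_def)
    finally show "v \<in> span B" .
  qed
  moreover have "B \<subseteq> vertices m" using assms by (auto simp: B_def E_def corners_def)
  moreover have "card B = m + 2"
  proof -
    have "card E = m" unfolding E_def by (subst card_image) (auto intro: inj_onI)
    then show ?thesis by (auto simp: B_def E_def card_insert_if)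
  qed
  ultimately show ?thesis by (auto simp: hp.is_basis_def)
qed

lemma is_basis_vertices_iff:
  assumes "m \<ge> 1"
  shows "hp.is_basis m S \<longleftrightarrow> S \<subseteq> vertices m \<and> \<not> affine_dependent S \<and> card S = m + 2"
  using ex_basis_vertices[OF assms] hp.is_basis_card_eq[of m] hp.is_basis_if_card[of m]
    hp.affine_dependent_iff_dependent[of S m] by (metis hp.is_basis_def)

lemma triangulations_eq:
  assumes "m \<ge> 1"
  shows "T \<in> triangulations m \<longleftrightarrow> finite T \<and> (\<forall>S\<in>T. hp.is_basis m S) \<and>
     (\<Union>S\<in>T. convex hull S) = square_times_simplex m \<and>
     (\<forall>\<sigma>\<in>T. \<forall>\<tau>\<in>T. (convex hull \<sigma> \<inter> convex hull \<tau>) face_of (convex hull \<sigma>))"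
  by (simp add: triangulations_def triangulates_def extreme_points_square_times_simplex
      is_basis_vertices_iff[OF assms])

text \<open>Otherwise the \<open>k\<close>-th barycentric coordinate would vanish on
  \<open>S\<close> and hence on its span, which contains the vertices of level
  \<open>k\<close>.\<close>

lemma part_nonempty:
  assumes "hp.is_basis m S" "k \<in> {1..m}"
  shows "part S k \<noteq> {}"
proof
  assume "part S k = {}"
  note S = hp.is_basisD[OF assms(1)]
  have "coord k w = 0" if "w \<in> S" for w
  proof -
    obtain c i where "c \<in> corners" "w = vertex c i" using S(1) \<open>w \<in> S\<close> mem_vertices_iff by blast
    moreover have "w \<notin> part S k" using \<open>part S k = {}\<close> by simp
    ultimately show ?thesis using mem_part_iff[OF S(1), of w k] \<open>w \<in> S\<close> by auto
  qed
  moreover have "vertex (0, 0) k \<in> span S" using S(3) assms(2) by (intro subsetD[OF S(3)]) (simp add: corners_def)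
  ultimately show False
    using notin_span_if_kernel[OF linear_coord, of S k "vertex (0, 0) k"] by auto
qed

lemma sum_parts:
  assumes "S \<subseteq> vertices m" "finite S"
  shows "(\<Sum>k=1..m. \<Sum>w\<in>part S k. f w) = sum f S"
proof -
  have "sum f S = sum f (\<Union>k\<in>{1..m}. part S k)"
    using assms(1) by (intro arg_cong[of _ _ "sum f"])
      (fastforce simp: mem_part_iff[OF assms(1)] mem_vertices_iff)
  also have "\<dots> = (\<Sum>k=1..m. \<Sum>w\<in>part S k. f w)"
    using assms(2) by (intro sum.UNION_disjoint) (auto simp: mem_part_iff[OF assms(1)], simp add: part_def)
  finally show ?thesis by simp
qed

section \<open>Slices\<close>

text \<open>The cartesian type replaces the pair so that matrices, determinants and the measure of
  linear images apply.\<close>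

definition pos :: "point \<Rightarrow> real^2" where
  "pos x = vector [xpos x, ypos x]"

lemma pos_nth [simp]: "pos x $ 1 = xpos x" "pos x $ 2 = ypos x"
  by (simp_all add: pos_def)

lemma vec2_eq_iff: "p = q \<longleftrightarrow> p $ 1 = q $ 1 \<and> p $ 2 = q $ 2" for p q :: "real^2"
  by (simp add: vec_eq_iff forall_2)

text \<open>
  Slicing at the barycentre of the simplex and scaling by \<open>m\<close> is the Cayley trick: the slice of
  \<open>convex hull S\<close> is the Minkowski sum of the convex hulls of the parts of \<open>S\<close>.
\<close>

definition lift :: "nat \<Rightarrow> real^2 \<Rightarrow> point" where
  "lift m p = ((p $ 1 / m, p $ 2 / m), \<Sum>k=1..m. (1 / m) *\<^sub>R simplex_vertex k)"

definition slice :: "nat \<Rightarrow> point set \<Rightarrow> (real^2) set" where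
  "slice m X = lift m -` X"

lemma coord_lift [simp]: "coord k (lift m p) = (if k \<in> {1..m} then 1 / m else 0)"
proof -
  have "coord k (lift m p) = (\<Sum>i=1..m. if i = k then 1 / m else 0)"
    unfolding coord_def lift_def snd_conv lookup_sum
    by (intro sum.cong) (auto simp: simplex_vertex_def lookup_single)
  also have "\<dots> = (if k \<in> {1..m} then 1 / m else 0)" by (rule sum.delta) simp
  finally show ?thesis .
qed

lemma xpos_lift [simp]: "xpos (lift m p) = p $ 1 / m" and ypos_lift [simp]: "ypos (lift m p) = p $ 2 / m"
  by (simp_all add: xpos_def ypos_def lift_def)

lemma coord_sum_part:
  assumes "S \<subseteq> vertices m"
  shows "coord k (\<Sum>w\<in>S. u w *\<^sub>R w) = sum u (part S k)"
proof -
  have fin: "finite S" using assms hp.finite_V finite_subset by blast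
  have "coord k (\<Sum>w\<in>S. u w *\<^sub>R w) = (\<Sum>w\<in>S. u w * coord k w)"
    by (simp add: linear_sum[OF linear_coord] linear_cmul[OF linear_coord])
  also have "\<dots> = (\<Sum>w\<in>part S k. u w * coord k w)"
  proof (rule sum.mono_neutral_right[OF fin])
    show "part S k \<subseteq> S" by (simp add: part_def)
    show "\<forall>w\<in>S - part S k. u w * coord k w = 0"
    proof
      fix w assume w: "w \<in> S - part S k"
      then obtain c i where "c \<in> corners" "w = vertex c i" using assms mem_vertices_iff by blast
      then show "u w * coord k w = 0" using w mem_part_iff[OF assms, of w k] by auto
    qed
  qed
  also have "\<dots> = sum u (part S k)"
    by (intro sum.cong) (auto simp: mem_part_iff[OF assms])
  finally show ?thesis .
qed

lemma part_outside: "S \<subseteq> vertices m \<Longrightarrow> k \<notin> {1..m} \<Longrightarrow> part S k = {}"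
  using mem_part_iff[of S m _ k] by (metis equals0I subsetD vertex_mem_vertices)

text \<open>The \<open>k\<close>-th coordinate of a convex combination is its mass on
  \<open>part S k\<close>, which is \<open>1 / m\<close> over the barycentre. Multiplying by
  \<open>m\<close> turns the masses on each level into a convex combination of their own.\<close>

lemma mem_slice_convex_hull:
  assumes "S \<subseteq> vertices m" "m \<ge> 1"
  shows "p \<in> slice m (convex hull S) \<longleftrightarrow>
    (\<exists>u. (\<forall>w\<in>S. 0 \<le> u w) \<and> (\<forall>k\<in>{1..m}. sum u (part S k) = 1) \<and> p = (\<Sum>w\<in>S. u w *\<^sub>R pos w))"
proof
  have fin: "finite S" using assms hp.finite_V finite_subset by blast
  {
    assume "p \<in> slice m (convex hull S)"
    then obtain u where u: "\<forall>w\<in>S. 0 \<le> u w" "(\<Sum>w\<in>S. u w *\<^sub>R w) = lift m p"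
      using hp.mem_convex_hull_V[OF assms(1)] by (auto simp: slice_def)
    define u' where "u' w = m * u w" for w
    have u': "(\<Sum>w\<in>S. u' w *\<^sub>R w) = real m *\<^sub>R lift m p"
      by (simp add: u'_def u(2)[symmetric] scaleR_sum_right)
    have "sum u' (part S k) = 1" if "k \<in> {1..m}" for k
      using that assms(2) unfolding coord_sum_part[OF assms(1), symmetric] u'
      by (simp add: linear_cmul[OF linear_coord])
    moreover have "p = (\<Sum>w\<in>S. u' w *\<^sub>R pos w)"
      using arg_cong[OF u', of xpos] arg_cong[OF u', of ypos] assms(2)
      by (simp add: vec2_eq_iff linear_sum[OF linear_xpos] linear_cmul[OF linear_xpos]
          linear_sum[OF linear_ypos] linear_cmul[OF linear_ypos])
    moreover have "\<forall>w\<in>S. 0 \<le> u' w" using u by (simp add: u'_def)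
    ultimately show "\<exists>u. (\<forall>w\<in>S. 0 \<le> u w) \<and> (\<forall>k\<in>{1..m}. sum u (part S k) = 1) \<and> p = (\<Sum>w\<in>S. u w *\<^sub>R pos w)"
      by blast
  next
    assume "\<exists>u. (\<forall>w\<in>S. 0 \<le> u w) \<and> (\<forall>k\<in>{1..m}. sum u (part S k) = 1) \<and> p = (\<Sum>w\<in>S. u w *\<^sub>R pos w)"
    then obtain u where u: "\<forall>w\<in>S. 0 \<le> u w" "\<forall>k\<in>{1..m}. sum u (part S k) = 1" "p = (\<Sum>w\<in>S. u w *\<^sub>R pos w)"
      by blast
    define u' where "u' w = u w / m" for w
    have s: "sum u' (part S k) = (if k \<in> {1..m} then 1 / m else 0)" for k
      using u(2) part_outside[OF assms(1), of k] by (simp add: u'_def sum_divide_distrib[symmetric])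
    have "(\<Sum>w\<in>S. u' w *\<^sub>R w) = lift m p"
    proof (rule point_eqI)
      show "coord k (\<Sum>w\<in>S. u' w *\<^sub>R w) = coord k (lift m p)" for k
        by (simp add: coord_sum_part[OF assms(1)] s)
    qed (simp_all add: u(3) u'_def linear_sum[OF linear_xpos] linear_cmul[OF linear_xpos]
          linear_sum[OF linear_ypos] linear_cmul[OF linear_ypos] sum_divide_distrib)
    moreover have "sum u' S = 1"
      using assms(2) by (simp add: sum_parts[OF assms(1) fin, symmetric] s)
    ultimately show "p \<in> slice m (convex hull S)"
      using u(1) unfolding slice_def vimage_eq hp.mem_convex_hull_V[OF assms(1)]
      by (intro exI[of _ u']) (auto simp: u'_def)
  }
qed

lemma slice_square_times_simplex:
  assumes "m \<ge> 1"
  shows "slice m (square_times_simplex m) = cbox 0 (\<chi> i. real m)"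
proof -
  have "(\<Sum>k=1..m. (1 / real m) *\<^sub>R simplex_vertex k) \<in> std_simplex m"
    unfolding std_simplex_def using assms
    by (intro convex_sum) (auto intro: hull_inc)
  then have "p \<in> slice m (square_times_simplex m) \<longleftrightarrow> p \<in> cbox 0 (\<chi> i. real m)" for p
    using assms by (simp add: slice_def lift_def square_times_simplex_def square_def mem_box_cart forall_2 field_simps)
  then show ?thesis by blast
qed

lemma measure_slice_square_times_simplex:
  assumes "m \<ge> 1"
  shows "measure lebesgue (slice m (square_times_simplex m)) = (real m)\<^sup>2"
proof -
  have "measure lborel (cbox 0 (\<chi> i. real m) :: (real^2) set) = real m * real m"
    by (subst content_cbox_cart) (simp_all add: interval_ne_empty_cart UNIV_2)
  then show ?thesis
    by (simp add: slice_square_times_simplex[OF assms] power2_eq_square)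
qed

lemma measure_affine_image:
  fixes D D' c :: "real^2"
  assumes "compact (K :: (real^2) set)"
  shows "(\<lambda>q. c + q $ 1 *\<^sub>R D + q $ 2 *\<^sub>R D') ` K \<in> lmeasurable"
    and "measure lebesgue ((\<lambda>q. c + q $ 1 *\<^sub>R D + q $ 2 *\<^sub>R D') ` K) =
      \<bar>D $ 1 * D' $ 2 - D' $ 1 * D $ 2\<bar> * measure lebesgue K"
proof -
  define f where "f q = q $ 1 *\<^sub>R D + q $ 2 *\<^sub>R D'" for q :: "real^2"
  have lin: "linear f" by (rule linearI) (auto simp: f_def algebra_simps)
  have K: "K \<in> lmeasurable" using assms by (rule lmeasurable_compact)
  have eq: "(\<lambda>q. c + q $ 1 *\<^sub>R D + q $ 2 *\<^sub>R D') ` K = (+) c ` f ` K"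
    by (auto simp: f_def image_image add.assoc)
  have det: "det (matrix f) = D $ 1 * D' $ 2 - D' $ 1 * D $ 2"
    by (simp add: det_2 matrix_def f_def axis_def)
  show "(\<lambda>q. c + q $ 1 *\<^sub>R D + q $ 2 *\<^sub>R D') ` K \<in> lmeasurable"
    unfolding eq by (intro measurable_translation measurable_linear_image lin K)
  show "measure lebesgue ((\<lambda>q. c + q $ 1 *\<^sub>R D + q $ 2 *\<^sub>R D') ` K) =
      \<bar>D $ 1 * D' $ 2 - D' $ 1 * D $ 2\<bar> * measure lebesgue K"
    unfolding eq measure_translation measure_linear_image[OF lin K] det ..
qed

lemma unit_square: "{q :: real^2. 0 \<le> q $ 1 \<and> 0 \<le> q $ 2 \<and> q $ 1 \<le> 1 \<and> q $ 2 \<le> 1} = cbox 0 1"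
  by (auto simp: mem_box_cart forall_2)

lemma unit_triangle: "{q :: real^2. 0 \<le> q $ 1 \<and> 0 \<le> q $ 2 \<and> q $ 1 + q $ 2 \<le> 1} = convex hull (insert 0 Basis)"
  unfolding std_simplex by (auto simp: Basis_vec_def inner_axis forall_2 UNIV_2 axis_eq_axis)

lemma measure_unit_square: "measure lebesgue (cbox 0 1 :: (real^2) set) = 1"
  by (simp add: content_cbox_cart interval_eq_empty_cart)

lemma measure_unit_triangle: "measure lebesgue (convex hull (insert 0 Basis) :: (real^2) set) = 1 / 2"
proof -
  have "compact (convex hull (insert 0 Basis) :: (real^2) set)"
    by (intro finite_imp_compact_convex_hull) simp
  then have "convex hull (insert 0 Basis) \<in> sets (borel :: (real^2) measure)" by (intro borel_closed compact_imp_closed)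
  then show ?thesis using content_std_simplex[where 'a = "real^2"] by simp
qed

section \<open>Areas of the slices\<close>

definition diagonal :: "nat \<Rightarrow> point set" where
  "diagonal i = {vertex (0, 0) i, vertex (1, 1) i}"

definition antidiagonal :: "nat \<Rightarrow> point set" where
  "antidiagonal i = {vertex (0, 1) i, vertex (1, 0) i}"

text \<open>The pair of levels is ordered: the diagonal comes first and the antidiagonal second.
  These two directions have a determinant of absolute value 2.\<close>

definition doubled :: "point set \<Rightarrow> nat \<Rightarrow> nat \<Rightarrow> bool" where
  "doubled S i j \<longleftrightarrow> part S i = diagonal i \<and> part S j = antidiagonal j"

definition double_simplex :: "nat \<Rightarrow> point set \<Rightarrow> bool" where
  "double_simplex m S \<longleftrightarrow> (\<exists>i\<in>{1..m}. \<exists>j\<in>{1..m}. doubled S i j)"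

text \<open>A basis has \<open>m + 2\<close> elements and meets every level, so it consists of one
  representative \<open>a k\<close> per level and two extra points. The slice is a triangle if the
  extra points share a level and a parallelogram otherwise.\<close>

locale basis_frame =
  fixes m :: nat and S :: "point set" and a :: "nat \<Rightarrow> point" and i j :: nat and r r' :: point
  assumes m: "m \<ge> 1" and basis: "hp.is_basis m S"
    and a_part: "\<And>k. k \<in> {1..m} \<Longrightarrow> a k \<in> part S k"
    and ij: "i \<in> {1..m}" "j \<in> {1..m}" and r_part: "r \<in> part S i" "r' \<in> part S j"
    and neq: "r \<noteq> r'" and r_neq: "\<And>k. k \<in> {1..m} \<Longrightarrow> a k \<noteq> r" "\<And>k. k \<in> {1..m} \<Longrightarrow> a k \<noteq> r'"
    and S_eq: "S = a ` {1..m} \<union> {r, r'}"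

lemma level_unique:
  assumes "S \<subseteq> vertices m" "x \<in> part S k" "x \<in> part S l"
  shows "k = l"
  using assms by (auto simp: mem_part_iff)

text \<open>An arithmetic test for the kind of an edge: the product of the coordinate differences is
  1 for the diagonal, -1 for the antidiagonal and 0 for a side.\<close>

lemma
  assumes "c \<in> corners" "d \<in> corners"
  shows edge_eq_diagonal_iff:
      "{vertex c k, vertex d k} = diagonal k \<longleftrightarrow> (fst d - fst c) * (snd d - snd c) = 1"
    and edge_eq_antidiagonal_iff:
      "{vertex c k, vertex d k} = antidiagonal k \<longleftrightarrow> (fst d - fst c) * (snd d - snd c) = -1"
  using assms unfolding corners_def diagonal_def antidiagonal_def doubleton_eq_iff
  by (elim SigmaE insertE emptyE; simp)+

lemma abs_det_corners:
  assumes "c \<in> corners" "d \<in> corners" "e \<in> corners"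
  shows "\<bar>(fst d - fst c) * (snd e - snd c) - (fst e - fst c) * (snd d - snd c)\<bar> \<in> {0, 1}"
  using assms unfolding corners_def by (elim SigmaE insertE emptyE; simp)

lemma corner_diff:
  assumes "c \<in> corners" "d \<in> corners"
  shows "fst d - fst c \<in> {-1, 0, 1}" "snd d - snd c \<in> {-1, 0, 1}"
  using assms unfolding corners_def by (elim SigmaE insertE emptyE; simp)+

text \<open>A nonzero determinant with entries in {-1, 0, 1} can reach absolute value 2 only if its
  two terms are nonzero and add up, that is, if one vector is a diagonal and the other an
  antidiagonal.\<close>

lemma abs_det_steps:
  fixes x y x' y' :: real
  assumes "x \<in> {-1, 0, 1}" "y \<in> {-1, 0, 1}" "x' \<in> {-1, 0, 1}" "y' \<in> {-1, 0, 1}" "x * y' - x' * y \<noteq> 0"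
  shows "\<bar>x * y' - x' * y\<bar> = 1 + of_bool (x * y = 1 \<and> x' * y' = -1 \<or> x' * y' = 1 \<and> x * y = -1)"
  using assms by (elim insertE emptyE; simp)

lemma coord_part:
  assumes "S \<subseteq> vertices m" "x \<in> part S k"
  shows "coord l x = (if l = k then 1 else 0)"
  using assms by (auto simp: mem_part_iff)

lemma ex_basis_frame:
  assumes m: "m \<ge> 1" and S: "hp.is_basis m S"
  shows "\<exists>a i j r r'. basis_frame m S a i j r r'"
proof -
  note SV = hp.is_basisD(1)[OF S] and fin = hp.is_basisD(4)[OF S]
  have "\<forall>k\<in>{1..m}. \<exists>x. x \<in> part S k" using part_nonempty[OF S] by blast
  then obtain a where a: "\<And>k. k \<in> {1..m} \<Longrightarrow> a k \<in> part S k" by metis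
  have "inj_on a {1..m}" using a level_unique[OF SV] by (metis inj_onI)
  then have "card (a ` {1..m}) = m" by (simp add: card_image)
  moreover have aS: "a ` {1..m} \<subseteq> S" using a by (auto simp: part_def)
  ultimately have "card (S - a ` {1..m}) = 2"
    using S is_basis_vertices_iff[OF m, of S] by (simp add: card_Diff_subset)
  then obtain r r' where r: "S - a ` {1..m} = {r, r'}" "r \<noteq> r'" by (meson card_2_iff)
  have part: "\<exists>i\<in>{1..m}. x \<in> part S i" if "x \<in> S" for x
    using that SV mem_part_iff[OF SV] mem_vertices_iff by blast
  obtain i j where "i \<in> {1..m}" "r \<in> part S i" "j \<in> {1..m}" "r' \<in> part S j"
    using part[of r] part[of r'] r by blast
  moreover have "\<And>k. k \<in> {1..m} \<Longrightarrow> a k \<noteq> r" "\<And>k. k \<in> {1..m} \<Longrightarrow> a k \<noteq> r'" using r by blast+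
  moreover have "S = a ` {1..m} \<union> {r, r'}" using r(1) aS by blast
  ultimately have "basis_frame m S a i j r r'"
    using m S a r(2) by (intro basis_frame.intro)
  then show ?thesis by blast
qed

section \<open>The slice of a single simplex\<close>

context basis_frame
begin

lemmas SV = hp.is_basisD(1)[OF basis] and fin = hp.is_basisD(4)[OF basis]

lemma inj_a: "k \<in> {1..m} \<Longrightarrow> l \<in> {1..m} \<Longrightarrow> a k = a l \<longleftrightarrow> k = l"
  using a_part level_unique[OF SV] by metis

lemma part_eq:
  assumes "k \<in> {1..m}"
  shows "part S k = {a k} \<union> (if k = i then {r} else {}) \<union> (if k = j then {r'} else {})"
proof -
  have "x \<in> part S k \<longleftrightarrow> x = a k \<or> k = i \<and> x = r \<or> k = j \<and> x = r'" for x
  proof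
    assume x: "x \<in> part S k"
    then have "x \<in> S" by (simp add: part_def)
    then consider l where "l \<in> {1..m}" "x = a l" | "x = r" | "x = r'" using S_eq by blast
    then show "x = a k \<or> k = i \<and> x = r \<or> k = j \<and> x = r'"
      using x a_part r_part level_unique[OF SV] by cases metis+
  qed (use a_part[OF assms] r_part in blast)
  then show ?thesis by auto
qed

lemma sum_part:
  fixes f :: "point \<Rightarrow> 'b::comm_monoid_add"
  assumes "k \<in> {1..m}"
  shows "sum f (part S k) = f (a k) + (if k = i then f r else 0) + (if k = j then f r' else 0)"
  using neq r_neq[OF assms] by (auto simp: part_eq[OF assms] add_ac)

lemma sum_S:
  fixes f :: "point \<Rightarrow> 'b::comm_monoid_add"
  shows "sum f S = (\<Sum>k=1..m. f (a k)) + f r + f r'"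
proof -
  have "sum f S = (\<Sum>k=1..m. f (a k) + (if k = i then f r else 0) + (if k = j then f r' else 0))"
    unfolding sum_parts[OF SV fin, symmetric] by (intro sum.cong refl sum_part)
  also have "\<dots> = (\<Sum>k=1..m. f (a k)) + f r + f r'"
    using ij by (simp add: sum.distrib)
  finally show ?thesis .
qed

definition D :: "real^2" where "D = pos r - pos (a i)"
definition D' :: "real^2" where "D' = pos r' - pos (a j)"

text \<open>The parameter domain of the slice: the coordinates are the masses moved from
  \<open>a i\<close> to \<open>r\<close> and from \<open>a j\<close> to \<open>r'\<close>. When
  \<open>i = j\<close> both are taken from the same unit of mass, which gives a triangle instead of
  a square.\<close>

definition K :: "(real^2) set" where
  "K = (if i = j then convex hull (insert 0 Basis) else cbox 0 1)"

lemma mem_K_iff: "q \<in> K \<longleftrightarrow> 0 \<le> q $ 1 \<and> 0 \<le> q $ 2 \<and>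
    (if i = j then q $ 1 + q $ 2 \<le> 1 else q $ 1 \<le> 1 \<and> q $ 2 \<le> 1)"
  by (simp add: K_def unit_square[symmetric] unit_triangle[symmetric])

lemma sum_rebase:
  fixes x y :: real
  shows "(\<Sum>k=1..m. (1 - (if k = i then x else 0) - (if k = j then y else 0)) *\<^sub>R pos (a k)) + x *\<^sub>R pos r + y *\<^sub>R pos r'
    = (\<Sum>k=1..m. pos (a k)) + x *\<^sub>R D + y *\<^sub>R D'"
proof -
  have "(\<Sum>k=1..m. (1 - (if k = i then x else 0) - (if k = j then y else 0)) *\<^sub>R pos (a k))
    = (\<Sum>k=1..m. pos (a k) - (if k = i then x *\<^sub>R pos (a k) else 0) - (if k = j then y *\<^sub>R pos (a k) else 0))"
    by (intro sum.cong) (auto simp: scaleR_diff_left)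
  also have "\<dots> = (\<Sum>k=1..m. pos (a k)) - x *\<^sub>R pos (a i) - y *\<^sub>R pos (a j)"
    using ij by (simp add: sum_subtractf)
  finally show ?thesis by (simp add: D_def D'_def algebra_simps)
qed

lemma slice_eq:
  "slice m (convex hull S) = (\<lambda>q. (\<Sum>k=1..m. pos (a k)) + q $ 1 *\<^sub>R D + q $ 2 *\<^sub>R D') ` K"
proof (intro set_eqI iffI)
  fix p assume "p \<in> slice m (convex hull S)"
  then obtain u where u: "\<forall>w\<in>S. 0 \<le> u w" "\<forall>k\<in>{1..m}. sum u (part S k) = 1" "p = (\<Sum>w\<in>S. u w *\<^sub>R pos w)"
    unfolding mem_slice_convex_hull[OF SV m] by blast
  have ua: "u (a k) = 1 - (if k = i then u r else 0) - (if k = j then u r' else 0)" if "k \<in> {1..m}" for k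
    using u(2) that sum_part[OF that, of u] by fastforce
  have "p = (\<Sum>k=1..m. u (a k) *\<^sub>R pos (a k)) + u r *\<^sub>R pos r + u r' *\<^sub>R pos r'"
    unfolding u(3) by (rule sum_S)
  also have "\<dots> = (\<Sum>k=1..m. pos (a k)) + u r *\<^sub>R D + u r' *\<^sub>R D'"
    unfolding sum_rebase[symmetric] by (simp add: ua)
  finally have p: "p = (\<Sum>k=1..m. pos (a k)) + u r *\<^sub>R D + u r' *\<^sub>R D'" .
  have inS: "r \<in> S" "r' \<in> S" "a i \<in> S" "a j \<in> S" using S_eq ij by auto
  have "(vector [u r, u r'] :: real^2) \<in> K"
    using u(1) inS ua[OF ij(1)] ua[OF ij(2)] unfolding mem_K_iff by (fastforce split: if_splits)
  then show "p \<in> (\<lambda>q. (\<Sum>k=1..m. pos (a k)) + q $ 1 *\<^sub>R D + q $ 2 *\<^sub>R D') ` K"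
    using p by (intro image_eqI[of _ _ "vector [u r, u r']"]) auto
next
  fix p assume "p \<in> (\<lambda>q. (\<Sum>k=1..m. pos (a k)) + q $ 1 *\<^sub>R D + q $ 2 *\<^sub>R D') ` K"
  then obtain q where q: "q \<in> K" "p = (\<Sum>k=1..m. pos (a k)) + q $ 1 *\<^sub>R D + q $ 2 *\<^sub>R D'" by blast
  \<comment> \<open>Each representative keeps what the extra points of its level leave over; for
    \<open>i = j\<close> both masses are subtracted from \<open>a i\<close>.\<close>
  define u where "u w = (if w = r then q $ 1 else if w = r' then q $ 2 else
      1 - (if w = a i then q $ 1 else 0) - (if w = a j then q $ 2 else 0))" for w
  have ua: "u (a k) = 1 - (if k = i then q $ 1 else 0) - (if k = j then q $ 2 else 0)" if "k \<in> {1..m}" for k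
    using r_neq[OF that] inj_a[OF that] ij by (auto simp: u_def)
  have ur: "u r = q $ 1" "u r' = q $ 2" using neq by (auto simp: u_def)
  have "0 \<le> u w" if "w \<in> S" for w
  proof -
    have "w = r \<or> w = r' \<or> (\<exists>k\<in>{1..m}. w = a k)" using that S_eq by blast
    then show ?thesis using q(1) ua ur by (auto simp: mem_K_iff split: if_splits)
  qed
  moreover have "sum u (part S k) = 1" if "k \<in> {1..m}" for k
    using ua[OF that] ur unfolding sum_part[OF that] by simp
  moreover have "p = (\<Sum>w\<in>S. u w *\<^sub>R pos w)"
    unfolding sum_S q(2) sum_rebase[symmetric] ur using ua by simp
  ultimately show "p \<in> slice m (convex hull S)"
    unfolding mem_slice_convex_hull[OF SV m] by blast
qed

text \<open>A relation between the planar vectors \<open>D\<close> and \<open>D'\<close> lifts to a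
  relation among elements of \<open>S\<close>, because each is a difference of two points on one
  level. Independence of \<open>S\<close> then makes its coefficients zero.\<close>

lemma det_nonzero: "D $ 1 * D' $ 2 - D' $ 1 * D $ 2 \<noteq> 0"
proof
  assume det: "D $ 1 * D' $ 2 - D' $ 1 * D $ 2 = 0"
  have rel: "x = 0 \<and> y = 0" if *: "x * D $ 1 + y * D' $ 1 = 0" "x * D $ 2 + y * D' $ 2 = 0" for x y
  proof -
    define z where "z = x *\<^sub>R (r - a i) + y *\<^sub>R (r' - a j)"
    have lev: "coord k r = coord k (a i)" "coord k r' = coord k (a j)" for k
      using r_part a_part[OF ij(1)] a_part[OF ij(2)] by (simp_all add: coord_part[OF SV])
    have z: "f z = x * (f r - f (a i)) + y * (f r' - f (a j))" if "linear f" for f :: "point \<Rightarrow> real"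
      by (simp add: z_def linear_add[OF that] linear_cmul[OF that] linear_diff[OF that])
    have "z = 0"
    proof (rule point_eqI)
      show "coord k z = coord k 0" for k
        using z[OF linear_coord, of k] lev linear_0[OF linear_coord] by simp
    qed (use * z[OF linear_xpos] z[OF linear_ypos] linear_0[OF linear_xpos] linear_0[OF linear_ypos]
        in \<open>simp_all add: D_def D'_def\<close>)
    have "\<exists>g. linear g \<and> (\<forall>w\<in>S. g w = (if w = v then 1 else 0::real))" for v
      using linear_independent_extend[OF hp.is_basisD(2)[OF basis], of "\<lambda>w. if w = v then 1 else 0"] by auto
    then obtain g where g: "\<And>v. linear (g v)" "\<And>v w. w \<in> S \<Longrightarrow> g v w = (if w = v then 1 else 0::real)"
      by metis
    have inS: "r \<in> S" "r' \<in> S" "a i \<in> S" "a j \<in> S" using S_eq ij by auto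
    have "g r z = x" "g r' z = y"
      using inS neq r_neq[OF ij(1)] r_neq[OF ij(2)] by (auto simp: z[OF g(1)] g(2))
    then show ?thesis using \<open>z = 0\<close> linear_0[OF g(1)] by simp
  qed
  \<comment> \<open>If the determinant vanishes, the first components, and likewise the second ones,
    are coefficients of such a relation. So \<open>D\<close> is zero, and the coefficients 1 and 0
    give a contradiction.\<close>
  have "D' $ 1 = 0 \<and> - D $ 1 = 0" using rel[of "D' $ 1" "- D $ 1"] det by (simp add: algebra_simps)
  moreover have "D' $ 2 = 0 \<and> - D $ 2 = 0" using rel[of "D' $ 2" "- D $ 2"] det by (simp add: algebra_simps)
  ultimately show False using rel[of 1 0] by simp
qed

lemma card_part: "k \<in> {1..m} \<Longrightarrow> card (part S k) = 1 + of_bool (k = i) + of_bool (k = j)"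
  using neq r_neq[of k] by (auto simp: part_eq)

text \<open>A level with one or two vertices contributes the factor 0! or 1!. Only
  \<open>i = j\<close> produces a level with three vertices, and with it the factor 2!.\<close>

lemma weight_eq: "weight m S = (if i = j then 1 / 2 else 1)"
proof -
  have "(\<Prod>k=1..m. fact (simplex_type S k)) = (\<Prod>k=1..m. if k = i \<and> i = j then 2 else 1 :: real)"
    by (intro prod.cong) (auto simp: simplex_type_def card_part fact_2)
  also have "\<dots> = (if i = j then 2 else 1)" using ij by simp
  finally show ?thesis by (simp add: weight_def)
qed

lemma doubled_cases:
  assumes "k \<in> {1..m}" "l \<in> {1..m}" "doubled S k l"
  shows "i \<noteq> j \<and> (k = i \<and> l = j \<or> k = j \<and> l = i)"
proof -
  have "card (part S k) = 2" "card (part S l) = 2"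
    using assms(3) by (simp_all add: doubled_def diagonal_def antidiagonal_def)
  moreover have "k \<noteq> l"
    using assms(3) by (auto simp: doubled_def diagonal_def antidiagonal_def doubleton_eq_iff)
  ultimately show ?thesis
    using card_part[OF assms(1)] card_part[OF assms(2)]
    by (cases "k = i"; cases "k = j"; cases "l = i"; cases "l = j"; simp)
qed

lemma double_simplex_iff:
  "double_simplex m S \<longleftrightarrow> i \<noteq> j \<and> (doubled S i j \<or> doubled S j i)"
  using ij doubled_cases unfolding double_simplex_def by blast

lemma doubled_antisym: "doubled S i j \<Longrightarrow> \<not> doubled S j i"
  by (auto simp: doubled_def diagonal_def antidiagonal_def doubleton_eq_iff)

lemma ex_corner: "x \<in> part S k \<Longrightarrow> \<exists>c\<in>corners. x = vertex c k"
  by (simp add: mem_part_iff[OF SV])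

lemma abs_det_eq:
  "\<bar>D $ 1 * D' $ 2 - D' $ 1 * D $ 2\<bar> = 1 + of_bool (double_simplex m S)"
proof -
  obtain c0 c1 c2 c3 where c: "c0 \<in> corners" "c1 \<in> corners" "c2 \<in> corners" "c3 \<in> corners"
    "a i = vertex c0 i" "r = vertex c1 i" "a j = vertex c2 j" "r' = vertex c3 j"
    using ex_corner[OF a_part[OF ij(1)]] ex_corner[OF r_part(1)]
      ex_corner[OF a_part[OF ij(2)]] ex_corner[OF r_part(2)] by metis
  have Dc: "D $ 1 = fst c1 - fst c0" "D $ 2 = snd c1 - snd c0" "D' $ 1 = fst c3 - fst c2" "D' $ 2 = snd c3 - snd c2"
    unfolding D_def D'_def by (simp_all add: c(5-8))
  show ?thesis
  proof (cases "i = j")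
    case True
    then have "c2 = c0" using c by simp
    then have "\<bar>D $ 1 * D' $ 2 - D' $ 1 * D $ 2\<bar> \<in> {0, 1}"
      unfolding Dc by (simp only: abs_det_corners c(1-4))
    then show ?thesis using det_nonzero True by (simp add: double_simplex_iff)
  next
    case False
    have "part S i = {vertex c0 i, vertex c1 i}" "part S j = {vertex c2 j, vertex c3 j}"
      using False c(5-8) part_eq[OF ij(1)] part_eq[OF ij(2)] by auto
    then have "double_simplex m S \<longleftrightarrow> D $ 1 * D $ 2 = 1 \<and> D' $ 1 * D' $ 2 = -1 \<or> D' $ 1 * D' $ 2 = 1 \<and> D $ 1 * D $ 2 = -1"
      using False by (simp add: double_simplex_iff doubled_def c(1-4) Dc
          edge_eq_diagonal_iff edge_eq_antidiagonal_iff)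
    then show ?thesis
      using abs_det_steps[OF corner_diff[OF c(1,2)] corner_diff[OF c(3,4)] det_nonzero[unfolded Dc]]
      by (simp only: Dc)
  qed
qed

lemma slice_lmeasurable: "slice m (convex hull S) \<in> lmeasurable"
  and measure_slice: "measure lebesgue (slice m (convex hull S)) = weight m S + of_bool (double_simplex m S)"
proof -
  have "compact K" by (simp add: K_def finite_imp_compact_convex_hull)
  note image = measure_affine_image[OF this, of "\<Sum>k=1..m. pos (a k)" D D', folded slice_eq]
  show "slice m (convex hull S) \<in> lmeasurable" by (rule image)
  have "measure lebesgue K = weight m S"
    by (simp only: K_def weight_eq measure_unit_triangle measure_unit_square split: if_split) simp
  then show "measure lebesgue (slice m (convex hull S)) = weight m S + of_bool (double_simplex m S)"
    unfolding image(2) abs_det_eq by (cases "double_simplex m S") (auto simp: double_simplex_iff weight_eq)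
qed

end

lemma
  assumes "m \<ge> 1" "hp.is_basis m S"
  shows slice_lmeasurable: "slice m (convex hull S) \<in> lmeasurable"
    and measure_slice:
      "measure lebesgue (slice m (convex hull S)) = weight m S + of_bool (double_simplex m S)"
    and card_part_le: "k \<in> {1..m} \<Longrightarrow> card (part S k) \<le> 3"
    and doubled_unique: "\<lbrakk>doubled S k l; doubled S k' l'; {k, l, k', l'} \<subseteq> {1..m}\<rbrakk> \<Longrightarrow> k = k' \<and> l = l'"
proof -
  obtain a i j r r' where "basis_frame m S a i j r r'" using ex_basis_frame[OF assms] by blast
  then interpret basis_frame m S a i j r r' .
  show "slice m (convex hull S) \<in> lmeasurable"
    "measure lebesgue (slice m (convex hull S)) = weight m S + of_bool (double_simplex m S)"
    by (rule slice_lmeasurable, rule measure_slice)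
  show "card (part S k) \<le> 3" if "k \<in> {1..m}"
    by (simp add: card_part[OF that])
  show "k = k' \<and> l = l'" if "doubled S k l" "doubled S k' l'" "{k, l, k', l'} \<subseteq> {1..m}"
    using that doubled_cases[of k l] doubled_cases[of k' l'] doubled_antisym by auto
qed

section \<open>The lower bound\<close>

text \<open>The slices cover the square of side \<open>m\<close>, and the measure of a finite union
  is at most the sum of the measures, which are the weights plus 1 for each double simplex.\<close>

lemma weight_sum_ge_area:
  assumes m: "m \<ge> 1" and T: "T \<in> triangulations m"
  shows "(real m)\<^sup>2 \<le> (\<Sum>S\<in>T. weight m S) + card {S\<in>T. double_simplex m S}"
proof -
  have fin: "finite T" and basis: "\<And>S. S \<in> T \<Longrightarrow> hp.is_basis m S"
    and cover: "(\<Union>S\<in>T. convex hull S) = square_times_simplex m"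
    using T unfolding triangulations_eq[OF m] by auto
  have "(real m)\<^sup>2 = measure lebesgue (\<Union>S\<in>T. slice m (convex hull S))"
    unfolding measure_slice_square_times_simplex[OF m, symmetric] cover[symmetric]
    by (simp add: slice_def vimage_UN)
  also have "\<dots> \<le> (\<Sum>S\<in>T. measure lebesgue (slice m (convex hull S)))"
    using fin slice_lmeasurable[OF m basis] by (intro measure_UNION_le) (auto simp: fmeasurable_def)
  also have "\<dots> = (\<Sum>S\<in>T. weight m S + of_bool (double_simplex m S))"
    using measure_slice[OF m basis] by (intro sum.cong) auto
  also have "\<dots> = (\<Sum>S\<in>T. weight m S) + card {S\<in>T. double_simplex m S}"
    using fin by (simp add: sum.distrib of_bool_def sum.If_cases Int_def)
  finally show ?thesis .
qed

section \<open>Counting the double simplices of a triangulation\<close>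

context
  fixes m :: nat and T :: "point set set"
  assumes m: "m \<ge> 1" and T: "T \<in> triangulations m"
begin

lemma T_basis: "S \<in> T \<Longrightarrow> hp.is_basis m S"
  using T unfolding triangulations_eq[OF m] by auto

text \<open>The face condition passes from a point of \<tau> to every point of \<sigma> that takes
  part in it with positive mass, so \<open>w\<close> lies in the hull of \<tau>. Being extreme in
  the whole polytope, \<open>w\<close> is extreme in that hull and hence a vertex of \<tau>.\<close>

lemma face_vertex_mem:
  assumes \<sigma>: "\<sigma> \<in> T" and \<tau>: "\<tau> \<in> T" and w: "w \<in> \<sigma>" and z: "z \<in> convex hull \<sigma>" and t: "0 \<le> t" "t < 1"
    and x: "(1 - t) *\<^sub>R w + t *\<^sub>R z \<in> convex hull \<tau>"
  shows "w \<in> \<tau>"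
proof -
  have face: "(convex hull \<sigma> \<inter> convex hull \<tau>) face_of (convex hull \<sigma>)"
    and P: "convex hull \<tau> \<subseteq> square_times_simplex m"
    using T \<sigma> \<tau> unfolding triangulations_eq[OF m] by auto
  have w': "w \<in> convex hull \<sigma>" using w by (rule hull_inc)
  have "w \<in> convex hull \<tau>"
  \<comment> \<open>In these two cases the point is \<open>w\<close> itself, and there is no open
    segment to which the face property could be applied.\<close>
  proof (cases "t = 0 \<or> w = z")
    case True
    then show ?thesis using x by (auto simp: algebra_simps)
  next
    case False
    then have "(1 - t) *\<^sub>R w + t *\<^sub>R z \<in> open_segment w z"
      using t by (auto simp: in_segment intro!: exI[of _ t])
    moreover have "(1 - t) *\<^sub>R w + t *\<^sub>R z \<in> convex hull \<sigma>"
      using convexD_alt[OF convex_convex_hull w' z] t by auto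
    ultimately show ?thesis using face w' z x unfolding face_of_def by blast
  qed
  moreover have "w extreme_point_of square_times_simplex m"
    using extreme_points_square_times_simplex[of m] hp.is_basisD(1)[OF T_basis[OF \<sigma>]] w by blast
  ultimately have "w extreme_point_of convex hull \<tau>"
    using P unfolding extreme_point_of_def by blast
  then show ?thesis by (rule extreme_point_of_convex_hull)
qed

text \<open>The two diagonals share their midpoint. The face condition then forces the ends of the
  diagonal into \<tau>, which would have four vertices on level \<open>i\<close>, while a basis has
  at most three.\<close>

lemma not_diagonal_and_antidiagonal:
  assumes \<sigma>: "\<sigma> \<in> T" and \<tau>: "\<tau> \<in> T" and i: "i \<in> {1..m}" and d: "diagonal i \<subseteq> \<sigma>" and a: "antidiagonal i \<subseteq> \<tau>"
  shows False
proof -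
  have mid: "(1 / 2) *\<^sub>R vertex (0, 0) i + (1 / 2) *\<^sub>R vertex (1, 1) i =
      (1 / 2) *\<^sub>R vertex (0, 1) i + (1 / 2) *\<^sub>R vertex (1, 0) i"
    by (simp add: vertex_def)
  have "(1 / 2) *\<^sub>R vertex (0, 1) i + (1 / 2) *\<^sub>R vertex (1, 0) i \<in> convex hull \<tau>"
    using a by (intro convexD[OF convex_convex_hull]) (auto simp: antidiagonal_def intro: hull_inc)
  note x = this[folded mid]
  have "vertex (0, 0) i \<in> \<tau>" "vertex (1, 1) i \<in> \<tau>"
    using face_vertex_mem[OF \<sigma> \<tau>, of "vertex (0, 0) i" "vertex (1, 1) i" "1 / 2"]
      face_vertex_mem[OF \<sigma> \<tau>, of "vertex (1, 1) i" "vertex (0, 0) i" "1 / 2"] x d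
    by (auto simp: diagonal_def add.commute intro: hull_inc)
  then have "{vertex (0, 0) i, vertex (1, 1) i, vertex (0, 1) i, vertex (1, 0) i} \<subseteq> part \<tau> i"
    using a hp.is_basisD(1)[OF T_basis[OF \<tau>]]
    by (auto simp: antidiagonal_def mem_part_iff corners_def)
  moreover have "finite (part \<tau> i)"
    using hp.is_basisD(4)[OF T_basis[OF \<tau>]] by (simp add: part_def)
  ultimately have "card {vertex (0, 0) i, vertex (1, 1) i, vertex (0, 1) i, vertex (1, 0) i} \<le> card (part \<tau> i)"
    by (rule card_mono[rotated])
  then show False using card_part_le[OF m T_basis[OF \<tau>] i] by simp
qed

text \<open>
  Moving a vertex within its level changes a point by a combination of the two diagonals, so near
  the centre of the common tetrahedron the two simplices overlap beyond it.
\<close>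

lemma doubled_subset:
  assumes \<sigma>: "\<sigma> \<in> T" and \<tau>: "\<tau> \<in> T" and ds: "doubled \<sigma> i j" and dt: "doubled \<tau> i j"
  shows "\<sigma> \<subseteq> \<tau>"
proof
  fix w assume w: "w \<in> \<sigma>"
  note SV = hp.is_basisD(1)[OF T_basis[OF \<sigma>]] and TV = hp.is_basisD(1)[OF T_basis[OF \<tau>]]
  obtain c k where c: "c \<in> corners" "k \<in> {1..m}" "w = vertex c k"
    using SV w mem_vertices_iff by blast
  obtain q where "q \<in> part \<tau> k" using part_nonempty[OF T_basis[OF \<tau>] c(2)] by blast
  then obtain d where d: "d \<in> corners" "vertex d k \<in> \<tau>" by (auto simp: mem_part_iff[OF TV])
  have F: "vertex (0, 0) i \<in> S" "vertex (1, 1) i \<in> S" "vertex (0, 1) j \<in> S" "vertex (1, 0) j \<in> S"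
    if "doubled S i j" for S
    using that by (auto simp: doubled_def diagonal_def antidiagonal_def part_def)
  \<comment> \<open>The coordinates of the corner difference \<open>c - d\<close> in terms of the
    directions (1, 1) and (1, -1).\<close>
  define x where "x = ((fst c - fst d) + (snd c - snd d)) / 2"
  define y where "y = ((fst c - fst d) - (snd c - snd d)) / 2"
  have xy: "\<bar>x\<bar> \<le> 1" "\<bar>y\<bar> \<le> 1" using c(1) d(1) by (auto simp: x_def y_def corners_def)
  \<comment> \<open>The point \<open>comb 0 0\<close> is the centre of the tetrahedron. Its
    displacement \<open>comb x y - comb 0 0\<close> has position part (c - d) / 8, so weights in the
    ratio 1 : 8 let it absorb the exchange of corners; the masses stay positive as \<bar>x\<bar> and
    \<bar>y\<bar> are at most 1.\<close>
  define comb where "comb x y =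
      (1 / 2) *\<^sub>R (((2 - x) / 4) *\<^sub>R vertex (0, 0) i + ((2 + x) / 4) *\<^sub>R vertex (1, 1) i) +
      (1 / 2) *\<^sub>R (((2 - y) / 4) *\<^sub>R vertex (0, 1) j + ((2 + y) / 4) *\<^sub>R vertex (1, 0) j)" for x y
  have comb: "comb x y \<in> convex hull S" if "doubled S i j" "\<bar>x\<bar> \<le> 1" "\<bar>y\<bar> \<le> 1" for S x y
    unfolding comb_def using F[OF that(1)] that(2,3)
    by (intro convexD[OF convex_convex_hull] hull_inc) (auto simp: field_simps)
  have "(1 / 9) *\<^sub>R w + (8 / 9) *\<^sub>R comb 0 0 = (1 / 9) *\<^sub>R vertex d k + (8 / 9) *\<^sub>R comb x y"
  proof (rule point_eqI)
    fix l
    show "coord l ((1 / 9) *\<^sub>R w + (8 / 9) *\<^sub>R comb 0 0) = coord l ((1 / 9) *\<^sub>R vertex d k + (8 / 9) *\<^sub>R comb x y)"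
      by (simp add: comb_def c linear_add[OF linear_coord] linear_cmul[OF linear_coord] field_simps)
  qed (simp_all add: comb_def c linear_add[OF linear_xpos] linear_cmul[OF linear_xpos]
      linear_add[OF linear_ypos] linear_cmul[OF linear_ypos], simp_all add: x_def y_def field_simps)
  moreover have "(1 / 9) *\<^sub>R vertex d k + (8 / 9) *\<^sub>R comb x y \<in> convex hull \<tau>"
    using hull_inc[OF d(2)] comb[OF dt xy] by (intro convexD[OF convex_convex_hull]) auto
  ultimately show "w \<in> \<tau>"
    using face_vertex_mem[OF \<sigma> \<tau> w comb[OF ds, of 0 0], of "8 / 9"] by simp
qed

text \<open>Double simplices inject into \<open>I \<times> J\<close>, where \<open>I\<close>
  collects the levels cut by their diagonal and \<open>J\<close> those cut by their antidiagonal.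
  These sets are disjoint in \<open>{1..m}\<close>, and the arithmetic-geometric mean inequality
  bounds the product.\<close>

lemma doubles_card: "4 * card {S\<in>T. double_simplex m S} \<le> m\<^sup>2"
proof -
  define I where "I = {i\<in>{1..m}. \<exists>S\<in>T. diagonal i \<subseteq> S}"
  define J where "J = {i\<in>{1..m}. \<exists>S\<in>T. antidiagonal i \<subseteq> S}"
  have "\<forall>S\<in>{S\<in>T. double_simplex m S}. \<exists>p. p \<in> {1..m} \<times> {1..m} \<and> doubled S (fst p) (snd p)"
  proof
    fix S assume "S \<in> {S\<in>T. double_simplex m S}"
    then obtain i j where "i \<in> {1..m}" "j \<in> {1..m}" "doubled S i j" by (auto simp: double_simplex_def)
    then show "\<exists>p. p \<in> {1..m} \<times> {1..m} \<and> doubled S (fst p) (snd p)" by (intro exI[of _ "(i, j)"]) simp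
  qed
  then obtain f where f: "\<And>S. S \<in> T \<Longrightarrow> double_simplex m S \<Longrightarrow> f S \<in> {1..m} \<times> {1..m} \<and> doubled S (fst (f S)) (snd (f S))"
    by (metis (no_types, lifting) mem_Collect_eq)
  have "card {S\<in>T. double_simplex m S} \<le> card (I \<times> J)"
  proof (rule card_inj_on_le)
    show "inj_on f {S\<in>T. double_simplex m S}"
      using f doubled_subset by (intro inj_onI) (metis (no_types, lifting) mem_Collect_eq subset_antisym)
    show "f ` {S\<in>T. double_simplex m S} \<subseteq> I \<times> J"
    proof
      fix p assume "p \<in> f ` {S\<in>T. double_simplex m S}"
      then obtain S where S: "S \<in> T" "double_simplex m S" "p = f S" by blast
      have "diagonal (fst p) \<subseteq> S" "antidiagonal (snd p) \<subseteq> S"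
        using f[OF S(1,2)] S(3) by (auto simp: doubled_def part_def)
      then show "p \<in> I \<times> J" using f[OF S(1,2)] S by (auto simp: I_def J_def mem_Times_iff)
    qed
  qed (simp add: I_def J_def)
  also have "\<dots> = card I * card J" by (rule card_cartesian_product)
  finally have le: "card {S\<in>T. double_simplex m S} \<le> card I * card J" .
  have "I \<inter> J = {}" using not_diagonal_and_antidiagonal by (auto simp: I_def J_def)
  then have "card I + card J = card (I \<union> J)" by (subst card_Un_disjoint) (auto simp: I_def J_def)
  also have "\<dots> \<le> card {1..m}" by (intro card_mono) (auto simp: I_def J_def)
  finally have sum: "card I + card J \<le> m" by simp
  have "4 * (card I * card J) \<le> (card I + card J)\<^sup>2"
  proof -
    have "4 * (int (card I) * int (card J)) \<le> (int (card I) + int (card J))\<^sup>2"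
      using zero_le_power2[of "int (card I) - int (card J)"] by (simp add: power2_eq_square algebra_simps)
    then show ?thesis by (metis (mono_tags) of_nat_add of_nat_le_iff of_nat_mult of_nat_numeral of_nat_power)
  qed
  also have "\<dots> \<le> m\<^sup>2" using sum by (rule power_mono) simp
  finally show ?thesis using le by linarith
qed

lemma weight_sum_ge: "real (m\<^sup>2 - m\<^sup>2 div 4) \<le> (\<Sum>S\<in>T. weight m S)"
proof -
  have "card {S\<in>T. double_simplex m S} \<le> m\<^sup>2 div 4" using doubles_card by linarith
  then have "real (card {S\<in>T. double_simplex m S}) \<le> real (m\<^sup>2 div 4)" by simp
  moreover have "real (m\<^sup>2 - m\<^sup>2 div 4) = (real m)\<^sup>2 - real (m\<^sup>2 div 4)" by (simp add: of_nat_diff)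
  ultimately show ?thesis using weight_sum_ge_area[OF m T] by linarith
qed

end

section \<open>The optimal triangulation\<close>

context
  fixes m :: nat
  assumes m: "m \<ge> 1"
begin

lemma basis_card: "hp.is_basis m S \<Longrightarrow> card S = m + 2"
  using is_basis_vertices_iff[OF m] by blast

lemma regular_simplices_triangulation:
  assumes "hp.generic_heights m h"
  shows "hp.regular_simplices m h \<in> triangulations m"
proof -
  have "(\<Union>S\<in>hp.regular_simplices m h. convex hull S) = convex hull vertices m"
    using hp.regular_simplices_cover[OF assms] hull_mono[of _ "vertices m" convex]
    by (fastforce simp: hp.regular_simplices_def hp.is_basis_def)
  then show ?thesis
    using hp.finite_regular_simplices hp.regular_simplices_face
    by (auto simp: triangulations_eq[OF m] convex_hull_vertices hp.regular_simplices_def)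
qed

text \<open>The separating functional restricts to an affine function on the slicing plane, and the
  overlap lies in its zero set. The point is that this restriction is not constant, so that the zero
  set is a line.\<close>

lemma negligible_slices_Int:
  assumes \<sigma>: "\<sigma> \<in> hp.regular_simplices m h" and \<tau>: "\<tau> \<in> hp.regular_simplices m h" and "\<sigma> \<noteq> \<tau>"
  shows "negligible (slice m (convex hull \<sigma>) \<inter> slice m (convex hull \<tau>))"
proof -
  have b\<sigma>: "hp.is_basis m \<sigma>" and b\<tau>: "hp.is_basis m \<tau>"
    using \<sigma> \<tau> by (auto simp: hp.regular_simplices_def)
  obtain f :: "point \<Rightarrow> real" where f: "linear f" and pos: "\<And>x. x \<in> convex hull \<sigma> \<Longrightarrow> 0 \<le> f x"
    and neg: "\<And>x. x \<in> convex hull \<tau> \<Longrightarrow> f x \<le> 0"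
    and f_pos: "\<And>v. v \<in> \<sigma> - \<tau> \<Longrightarrow> 0 < f v" and f_neg: "\<And>v. v \<in> \<tau> - \<sigma> \<Longrightarrow> f v < 0"
    using hp.regular_simplices_separated[OF \<sigma> \<tau>] by blast
  define n :: "real^2" where "n = vector [f ((1, 0), 0), f ((0, 1), 0)]"
  have f_split: "f x = f ((1, 0), 0) * fst (fst x) + f ((0, 1), 0) * snd (fst x) + f ((0, 0), snd x)" for x
  proof -
    have "x = fst (fst x) *\<^sub>R ((1, 0), 0) + snd (fst x) *\<^sub>R ((0, 1), 0) + ((0, 0), snd x)"
      by (simp add: prod_eq_iff)
    then have "f x = f (fst (fst x) *\<^sub>R ((1, 0), 0) + snd (fst x) *\<^sub>R ((0, 1), 0) + ((0, 0), snd x))"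
      by (rule arg_cong)
    then show ?thesis by (simp only: linear_add[OF f] linear_cmul[OF f]) simp
  qed
  have "n \<noteq> 0"
  proof
    assume "n = 0"
    then have n: "f ((1, 0), 0) = 0" "f ((0, 1), 0) = 0" by (simp_all add: n_def vec2_eq_iff)
    \<comment> \<open>With \<open>n = 0\<close> the functional is constant on each level. Both
      simplices have a vertex on the level, so the constant is both nonnegative and nonpositive;
      thus nothing could separate \<sigma> from \<tau>.\<close>
    have zero: "f (vertex c k) = 0" if k: "k \<in> {1..m}" for c k
    proof -
      have const: "f (vertex d k) = f (vertex c k)" for d
        by (simp add: f_split[of "vertex d k"] f_split[of "vertex c k"] n) (simp add: vertex_def)
      obtain x y where "x \<in> part \<sigma> k" "y \<in> part \<tau> k"
        using part_nonempty[OF b\<sigma> k] part_nonempty[OF b\<tau> k] by blast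
      then obtain d e where "vertex d k \<in> \<sigma>" "vertex e k \<in> \<tau>"
        using mem_part_iff[OF hp.is_basisD(1)[OF b\<sigma>], of x k] mem_part_iff[OF hp.is_basisD(1)[OF b\<tau>], of y k]
        by auto
      then have "0 \<le> f (vertex d k)" "f (vertex e k) \<le> 0" using pos[OF hull_inc] neg[OF hull_inc] by blast+
      then show ?thesis using const by (metis order_antisym)
    qed
    have "f v = 0" if "v \<in> vertices m" for v
    proof -
      obtain c k where "k \<in> {1..m}" "v = vertex c k" using \<open>v \<in> vertices m\<close> unfolding mem_vertices_iff by blast
      then show ?thesis using zero by simp
    qed
    then have "\<sigma> - \<tau> = {}" "\<tau> - \<sigma> = {}"
      using f_pos f_neg hp.is_basisD(1)[OF b\<sigma>] hp.is_basisD(1)[OF b\<tau>] by fastforce+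
    then show False using \<open>\<sigma> \<noteq> \<tau>\<close> by blast
  qed
  define b where "b = f ((0, 0), \<Sum>k=1..m. (1 / m) *\<^sub>R simplex_vertex k)"
  have lift: "f (lift m p) = (n \<bullet> p) / m + b" for p
    by (subst f_split) (simp add: lift_def n_def b_def inner_vec_def UNIV_2 add_divide_distrib)
  have "slice m (convex hull \<sigma>) \<inter> slice m (convex hull \<tau>) \<subseteq> {p. n \<bullet> p = - b * m}"
  proof
    fix p assume "p \<in> slice m (convex hull \<sigma>) \<inter> slice m (convex hull \<tau>)"
    then have "lift m p \<in> convex hull \<sigma>" "lift m p \<in> convex hull \<tau>" by (simp_all add: slice_def)
    then have "f (lift m p) = 0" using pos neg by (metis order_antisym)
    then show "p \<in> {p. n \<bullet> p = - b * m}" using m by (simp add: lift field_simps)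
  qed
  then show ?thesis using negligible_hyperplane[of n "- b * m"] \<open>n \<noteq> 0\<close> negligible_subset by blast
qed

lemma weight_sum_regular_le:
  assumes "hp.generic_heights m h"
  shows "(\<Sum>S\<in>hp.regular_simplices m h. weight m S)
    + card {S\<in>hp.regular_simplices m h. double_simplex m S} \<le> (real m)\<^sup>2"
proof -
  define T where "T = hp.regular_simplices m h"
  have T: "T \<in> triangulations m" unfolding T_def by (rule regular_simplices_triangulation[OF assms])
  have fin: "finite T" and basis: "\<And>S. S \<in> T \<Longrightarrow> hp.is_basis m S"
    and cover: "(\<Union>S\<in>T. convex hull S) = square_times_simplex m"
    using T unfolding triangulations_eq[OF m] by auto
  have "(\<Sum>S\<in>T. weight m S) + card {S\<in>T. double_simplex m S} = (\<Sum>S\<in>T. weight m S + of_bool (double_simplex m S))"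
    using fin by (simp add: sum.distrib of_bool_def sum.If_cases Int_def)
  also have "\<dots> = (\<Sum>S\<in>T. measure lebesgue (slice m (convex hull S)))"
    using measure_slice[OF m basis] by (intro sum.cong) auto
  also have "\<dots> = measure lebesgue (\<Union>S\<in>T. slice m (convex hull S))"
    using fin slice_lmeasurable[OF m basis] negligible_slices_Int
    by (intro measure_negligible_finite_Union_image[symmetric]) (auto simp: T_def pairwise_def)
  also have "\<dots> = (real m)\<^sup>2"
    unfolding measure_slice_square_times_simplex[OF m, symmetric] cover[symmetric]
    by (simp add: slice_def vimage_UN)
  finally show ?thesis by (simp add: T_def)
qed

section \<open>Heights and certificates for the double cells\<close>

text \<open>
  Levels up to \<open>split_point\<close> are cut by the diagonal, the others by the antidiagonal. The slope
  \<open>((i + j) / 2, (i - j) / 2)\<close> of the functional below is the crossing point of the long segments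
  \<open>x + y = i\<close> and \<open>x - y = j\<close> of the tropical curves of levels \<open>i\<close> and \<open>j\<close>; its value on each other
  level is the largest one that stays below the heights there. The height \<open>4 m + 4\<close> only has to be large.
\<close>

definition split_point :: nat where "split_point = m div 2"

text \<open>The two cheap corners of level \<open>k\<close> have heights 0 and \<open>k\<close>. A
  slope (p, q) treats them equally exactly when p + q = k on a diagonal level and p - q = k on an
  antidiagonal one, so \<open>k\<close> only shifts the long segment.\<close>

definition corner_height :: "real \<Rightarrow> real \<Rightarrow> nat \<Rightarrow> real" where
  "corner_height x y k = (if (k \<le> split_point) = (x = y) then x * k else 4 * m + 4)"

definition height :: "point \<Rightarrow> real" where
  "height v = (\<Sum>k=1..m. coord k v * corner_height (xpos v) (ypos v) k)"

lemma height_vertex: "k \<in> {1..m} \<Longrightarrow> height (vertex c k) = corner_height (fst c) (snd c) k"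
  by (simp add: height_def if_distrib[of "\<lambda>x. x * _"] cong: if_cong)

text \<open>The corner of level \<open>k\<close> that minimises height minus slope at the crossing
  point. Comparing the two cheap corners there amounts to the sign of \<open>k - i\<close> on
  diagonal levels and of \<open>k - j\<close> on the others.\<close>

definition selected :: "nat \<Rightarrow> nat \<Rightarrow> nat \<Rightarrow> real \<times> real" where
  "selected i j k = (if k \<le> split_point then if k < i then (1, 1) else (0, 0)
     else if k < j then (1, 0) else (0, 1))"

definition double_cell :: "nat \<Rightarrow> nat \<Rightarrow> point set" where
  "double_cell i j = diagonal i \<union> antidiagonal j \<union> (\<lambda>k. vertex (selected i j k) k) ` ({1..m} - {i, j})"

definition double_functional :: "nat \<Rightarrow> nat \<Rightarrow> point \<Rightarrow> real" where
  "double_functional i j v = (i + j) / 2 * xpos v + (real i - real j) / 2 * ypos v +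
     (\<Sum>k=1..m. coord k v * (if k \<le> split_point then min 0 (real k - i) else (real j - i) / 2 + min 0 (real k - j)))"

lemma linear_double_functional: "linear (double_functional i j)"
  by (rule linearI)
    (simp_all add: double_functional_def linear_add[OF linear_coord] linear_add[OF linear_xpos]
      linear_add[OF linear_ypos] linear_cmul[OF linear_coord] linear_cmul[OF linear_xpos]
      linear_cmul[OF linear_ypos] distrib_left distrib_right sum.distrib sum_distrib_left mult.assoc mult.left_commute)

lemma double_functional_vertex:
  "k \<in> {1..m} \<Longrightarrow> double_functional i j (vertex c k) =
    (i + j) / 2 * fst c + (real i - real j) / 2 * snd c +
    (if k \<le> split_point then min 0 (real k - i) else (real j - i) / 2 + min 0 (real k - j))"
  by (simp add: double_functional_def if_distrib[of "\<lambda>x. x * _"] cong: if_cong)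

context
  fixes i j :: nat
  assumes i: "1 \<le> i" "i \<le> split_point" and j: "split_point < j" "j \<le> m"
begin

lemma ij_range: "i \<in> {1..m}" "j \<in> {1..m}" "i \<noteq> j"
  using i j by auto

lemma part_double_cell:
  "vertex c k \<in> double_cell i j \<longleftrightarrow> k \<in> {1..m} \<and>
    (if k = i then c \<in> {(0, 0), (1, 1)} else if k = j then c \<in> {(0, 1), (1, 0)} else c = selected i j k)"
  using ij_range by (auto simp: double_cell_def diagonal_def antidiagonal_def)

lemma double_cell_subset: "double_cell i j \<subseteq> vertices m"
proof -
  have "selected i j k \<in> corners" for k by (simp add: selected_def corners_def)
  then show ?thesis
    using ij_range by (auto simp: double_cell_def diagonal_def antidiagonal_def) (auto simp: corners_def)
qed

text \<open>Once the corner and the position of \<open>k\<close> relative to \<open>i\<close>,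
  \<open>split_point\<close> and \<open>j\<close> are fixed, the claim is linear arithmetic; this
  makes four times six cases.\<close>

lemma double_functional_eq:
  assumes "c \<in> corners" "k \<in> {1..m}"
  shows "vertex c k \<in> double_cell i j \<Longrightarrow> double_functional i j (vertex c k) = height (vertex c k)"
    and "vertex c k \<notin> double_cell i j \<Longrightarrow> double_functional i j (vertex c k) < height (vertex c k)"
proof -
  have bounds: "1 \<le> real i" "real i < real j" "real j \<le> real m" "1 \<le> real k" "real k \<le> real m" using i j assms by auto
  have "c = (0, 0) \<or> c = (0, 1) \<or> c = (1, 0) \<or> c = (1, 1)" using assms(1) by (auto simp: corners_def)
  moreover have "k < i \<or> k = i \<or> (i < k \<and> k \<le> split_point) \<or> (split_point < k \<and> k < j) \<or> k = j \<or> j < k" by linarith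
  ultimately have "(vertex c k \<in> double_cell i j \<longrightarrow> double_functional i j (vertex c k) = height (vertex c k)) \<and>
    (vertex c k \<notin> double_cell i j \<longrightarrow> double_functional i j (vertex c k) < height (vertex c k))"
    unfolding part_double_cell height_vertex[OF assms(2)] double_functional_vertex[OF assms(2)]
    using i j bounds assms(2)
    by (elim disjE conjE; simp add: corner_height_def selected_def min_def field_simps)
  then show "vertex c k \<in> double_cell i j \<Longrightarrow> double_functional i j (vertex c k) = height (vertex c k)"
    and "vertex c k \<notin> double_cell i j \<Longrightarrow> double_functional i j (vertex c k) < height (vertex c k)" by blast+
qed

lemma double_cell_spans: "vertices m \<subseteq> span (double_cell i j)"
proof
  fix v assume "v \<in> vertices m"
  then obtain a b k where v: "k \<in> {1..m}" "v = vertex (a, b) k" by (auto simp: mem_vertices_iff)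
  obtain c where c: "vertex c k \<in> double_cell i j" using v(1) part_double_cell by (metis insertI1)
  \<comment> \<open>The doubled levels provide both diagonal directions, so any corner difference is
    expressed by its half-sum and half-difference.\<close>
  define x where "x = ((a - fst c) + (b - snd c)) / 2"
  define y where "y = ((a - fst c) - (b - snd c)) / 2"
  have "v = vertex c k + x *\<^sub>R (vertex (1, 1) i - vertex (0, 0) i) + y *\<^sub>R (vertex (1, 0) j - vertex (0, 1) j)"
    by (simp add: v vertex_def x_def y_def prod_eq_iff) (simp add: field_simps)
  also have "\<dots> \<in> span (double_cell i j)"
    using c ij_range by (intro span_add span_scale span_diff span_base) (auto simp: double_cell_def diagonal_def antidiagonal_def)
  finally show "v \<in> span (double_cell i j)" .
qed

text \<open>Independence follows from spanning together with the count: the cell has at most 2 + 2 +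
  (m - 2) elements, the size of a basis.\<close>

lemma double_cell_basis: "hp.is_basis m (double_cell i j)"
proof -
  obtain B where B: "hp.is_basis m B" using hp.ex_is_basis by blast
  have "card (double_cell i j) \<le> card (diagonal i \<union> antidiagonal j) + card ((\<lambda>k. vertex (selected i j k) k) ` ({1..m} - {i, j}))"
    unfolding double_cell_def by (rule card_Un_le)
  also have "card (diagonal i \<union> antidiagonal j) \<le> 2 + 2"
    by (rule order_trans[OF card_Un_le]) (simp add: diagonal_def antidiagonal_def)
  also have "card ((\<lambda>k. vertex (selected i j k) k) ` ({1..m} - {i, j})) \<le> card ({1..m} - {i, j})"
    by (rule card_image_le) simp
  also have "card ({1..m} - {i, j}) = m - 2"
    using ij_range by (subst card_Diff_subset) auto
  finally have "card (double_cell i j) \<le> card B"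
    using basis_card[OF B] ij_range by auto
  then show ?thesis by (rule hp.is_basis_if_spans[OF B double_cell_subset double_cell_spans])
qed

lemma double_cell_regular: "double_cell i j \<in> hp.regular_simplices m height"
  unfolding hp.regular_simplices_def
proof (intro CollectI conjI exI ballI)
  fix v
  show "double_functional i j v = height v" if "v \<in> double_cell i j"
  proof -
    obtain c k where "c \<in> corners" "k \<in> {1..m}" "v = vertex c k"
      using subsetD[OF double_cell_subset \<open>v \<in> double_cell i j\<close>] unfolding mem_vertices_iff by blast
    then show ?thesis using double_functional_eq(1) \<open>v \<in> double_cell i j\<close> by simp
  qed
  show "double_functional i j v < height v" if "v \<in> vertices m - double_cell i j"
  proof -
    obtain c k where "c \<in> corners" "k \<in> {1..m}" "v = vertex c k"
      using DiffD1[OF \<open>v \<in> vertices m - double_cell i j\<close>] unfolding mem_vertices_iff by blast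
    then show ?thesis using double_functional_eq(2) \<open>v \<in> vertices m - double_cell i j\<close> by simp
  qed
qed (use double_cell_basis linear_double_functional in auto)

lemma double_cell_doubled: "doubled (double_cell i j) i j"
proof -
  have "part (double_cell i j) k = {x. \<exists>c\<in>corners. x = vertex c k \<and> vertex c k \<in> double_cell i j}" for k
    by (auto simp: mem_part_iff[OF double_cell_subset])
  then show ?thesis
    using ij_range by (auto simp: doubled_def part_double_cell diagonal_def antidiagonal_def corners_def)
qed

end

text \<open>For small \<open>t\<close> the perturbed heights are generic and still have every double
  cell among their simplices. The area count bounds the weight from above, and the lower bound for
  all triangulations gives equality.\<close>

lemma ex_optimal_triangulation: "\<exists>T\<in>triangulations m. (\<Sum>S\<in>T. weight m S) = real (m\<^sup>2 - m\<^sup>2 div 4)"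
proof -
  define Q where "Q = {1..split_point} \<times> {split_point<..m}"
  obtain e0 :: "point \<Rightarrow> nat" where e0: "inj_on e0 (vertices m)"
    using finite_imp_inj_to_nat_seg[OF hp.finite_V[of m]] by blast
  \<comment> \<open>The successor makes all exponents positive, so the perturbation tends to zero
    with \<open>t\<close>.\<close>
  define e where "e = Suc \<circ> e0"
  have e: "inj_on e (vertices m)" "\<And>v. 0 < e v" using e0 by (auto simp: e_def inj_on_def)
  have "\<forall>\<^sub>F t in at_right 0. \<forall>p\<in>Q. double_cell (fst p) (snd p) \<in> hp.regular_simplices m (hp.perturbed height e t)"
    using double_cell_regular e(2)
    by (intro eventually_ball_finite ballI hp.eventually_mem_regular_simplices) (auto simp: Q_def)
  moreover have "\<forall>\<^sub>F t in at_right 0. hp.generic_heights m (hp.perturbed height e t)"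
    using e by (intro hp.eventually_generic_heights) auto
  ultimately have "\<forall>\<^sub>F t in at_right 0. (\<forall>p\<in>Q. double_cell (fst p) (snd p) \<in> hp.regular_simplices m (hp.perturbed height e t)) \<and>
      hp.generic_heights m (hp.perturbed height e t)"
    by (rule eventually_conj)
  then obtain t :: real where
    cells: "\<And>p. p \<in> Q \<Longrightarrow> double_cell (fst p) (snd p) \<in> hp.regular_simplices m (hp.perturbed height e t)"
    and gen: "hp.generic_heights m (hp.perturbed height e t)"
    using eventually_happens'[OF trivial_limit_at_right_real] by blast
  define T where "T = hp.regular_simplices m (hp.perturbed height e t)"
  have T: "T \<in> triangulations m" unfolding T_def by (rule regular_simplices_triangulation[OF gen])
  have fin: "finite T" unfolding T_def by (rule hp.finite_regular_simplices)
  have dbl: "doubled (double_cell (fst p) (snd p)) (fst p) (snd p)" "{fst p, snd p} \<subseteq> {1..m}"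
    "hp.is_basis m (double_cell (fst p) (snd p))" if "p \<in> Q" for p
    using that double_cell_doubled double_cell_basis by (auto simp: Q_def split_point_def)
  \<comment> \<open>Splitting the levels into halves as equal as possible maximises the number of
    pairs, which is then \<open>m\<^sup>2 div 4\<close>.\<close>
  have "split_point * (m - split_point) = card Q" by (simp add: Q_def card_cartesian_product)
  also have "\<dots> \<le> card {S\<in>T. double_simplex m S}"
  proof (rule card_inj_on_le)
    show "inj_on (\<lambda>p. double_cell (fst p) (snd p)) Q"
    proof (rule inj_onI)
      fix p q assume pq: "p \<in> Q" "q \<in> Q" "double_cell (fst p) (snd p) = double_cell (fst q) (snd q)"
      have "fst p = fst q \<and> snd p = snd q"
        using doubled_unique[OF m dbl(3)[OF pq(1)] dbl(1)[OF pq(1)]] dbl(1)[OF pq(2)] dbl(2)[OF pq(1)] dbl(2)[OF pq(2)] pq(3)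
        by auto
      then show "p = q" by (simp add: prod_eq_iff)
    qed
    show "(\<lambda>p. double_cell (fst p) (snd p)) ` Q \<subseteq> {S\<in>T. double_simplex m S}"
      using cells dbl unfolding T_def double_simplex_def by blast
  qed (use fin in simp)
  finally have "split_point * (m - split_point) \<le> card {S\<in>T. double_simplex m S}" .
  moreover have "split_point * (m - split_point) = m\<^sup>2 div 4"
    unfolding split_point_def by (cases "even m") (auto elim!: evenE oddE simp: power2_eq_square algebra_simps)
  ultimately have "real (m\<^sup>2 div 4) \<le> real (card {S\<in>T. double_simplex m S})" by simp
  moreover have "real (m\<^sup>2 - m\<^sup>2 div 4) = (real m)\<^sup>2 - real (m\<^sup>2 div 4)" by (simp add: of_nat_diff)
  ultimately have "(\<Sum>S\<in>T. weight m S) \<le> real (m\<^sup>2 - m\<^sup>2 div 4)"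
    using weight_sum_regular_le[OF gen] unfolding T_def by linarith
  then show ?thesis using weight_sum_ge[OF m T] T by (intro bexI[of _ T]) auto
qed

section \<open>The minimum and its asymptotics\<close>

lemma finite_triangulations: "finite (triangulations m)"
proof (rule finite_subset)
  show "triangulations m \<subseteq> Pow (Pow (vertices m))"
  proof
    fix T assume "T \<in> triangulations m"
    then have "\<forall>S\<in>T. hp.is_basis m S" unfolding triangulations_eq[OF m] by blast
    then show "T \<in> Pow (Pow (vertices m))" using hp.is_basisD(1) by blast
  qed
qed (simp add: hp.finite_V)

lemma rho2_eq_sqrt: "rho2 m = sqrt (real (m\<^sup>2 - m\<^sup>2 div 4) / (real m)\<^sup>2)"
  unfolding rho2_def
proof (rule Min_eqI)
  show "finite (weighted_efficiency m ` triangulations m)" using finite_triangulations by simp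
  show "sqrt (real (m\<^sup>2 - m\<^sup>2 div 4) / (real m)\<^sup>2) \<in> weighted_efficiency m ` triangulations m"
    using ex_optimal_triangulation by (force simp: weighted_efficiency_def)
  fix y assume "y \<in> weighted_efficiency m ` triangulations m"
  then show "sqrt (real (m\<^sup>2 - m\<^sup>2 div 4) / (real m)\<^sup>2) \<le> y"
    using weight_sum_ge[OF m] unfolding weighted_efficiency_def
    by (auto intro!: real_sqrt_le_mono divide_right_mono)
qed

end

text \<open>Subtracting from the integer \<open>m\<^sup>2\<close> exchanges rounding up and rounding
  down: three quarters rounded up is the whole minus one quarter rounded down.\<close>

lemma three_quarters_ceiling: "real_of_int \<lceil>3 * (real m)\<^sup>2 / 4\<rceil> = real (m\<^sup>2 - m\<^sup>2 div 4)"
proof -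
  have "\<lceil>3 * (real m)\<^sup>2 / 4\<rceil> = int (m\<^sup>2 - m\<^sup>2 div 4)"
  proof (rule ceiling_unique)
    have "4 * (m\<^sup>2 div 4) \<le> m\<^sup>2" "m\<^sup>2 < 4 * (m\<^sup>2 div 4) + 4" by linarith+
    then have "real (4 * (m\<^sup>2 div 4)) \<le> real (m\<^sup>2)" "real (m\<^sup>2) < real (4 * (m\<^sup>2 div 4) + 4)"
      by (simp_all only: of_nat_le_iff of_nat_less_iff)
    moreover have "real (m\<^sup>2 - m\<^sup>2 div 4) = real (m\<^sup>2) - real (m\<^sup>2 div 4)"
      by (rule of_nat_diff) simp
    ultimately show "real_of_int (int (m\<^sup>2 - m\<^sup>2 div 4)) - 1 < 3 * (real m)\<^sup>2 / 4"
      "3 * (real m)\<^sup>2 / 4 \<le> real_of_int (int (m\<^sup>2 - m\<^sup>2 div 4))" by simp_all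
  qed
  then show ?thesis by simp
qed

lemma rho2_formula: "m \<ge> 1 \<Longrightarrow> rho2 m = sqrt (real_of_int \<lceil>3 * (real m)\<^sup>2 / 4\<rceil> / (real m)\<^sup>2)"
  by (simp add: rho2_eq_sqrt three_quarters_ceiling)

lemma rho2_even:
  assumes "m \<ge> 1" "even m"
  shows "rho2 m = sqrt (3 / 4)"
proof -
  obtain n where "m = 2 * n" using assms(2) by blast
  then show ?thesis using assms(1) by (simp add: rho2_eq_sqrt power_mult_distrib of_nat_diff)
qed

text \<open>An odd square is 1 modulo 4, so rounding up adds exactly 1/4 to three quarters of
  it.\<close>

lemma rho2_odd:
  assumes "odd m"
  shows "rho2 m = sqrt (3 / 4 + 1 / (4 * (real m)\<^sup>2))"
proof -
  obtain n where n: "m = 2 * n + 1" using assms oddE by blast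
  have "m\<^sup>2 div 4 = n\<^sup>2 + n" using n by (simp add: power2_eq_square algebra_simps)
  then have "real (m\<^sup>2 - m\<^sup>2 div 4) = 3 * (real m)\<^sup>2 / 4 + 1 / 4"
    using n by (simp add: of_nat_diff power2_eq_square algebra_simps add_divide_distrib)
  then show ?thesis using n by (simp add: rho2_eq_sqrt field_simps)
qed

text \<open>The squares of \<open>rho2 m\<close> and of the limit differ by exactly
  \<open>1 / (4 * (real m)\<^sup>2)\<close>, and the sum of the two numbers lies between 1 and 2.
  Dividing gives the lower constant 1/8; the upper bound 1/4 is relaxed to 1.\<close>

lemma rho2_odd_bigtheta:
  "(\<lambda>m. rho2 m - sqrt (3 / 4)) \<in> \<Theta>[inf sequentially (principal {m. odd m})](\<lambda>m. 1 / (real m)\<^sup>2)"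
proof (rule bigthetaI'[of "1 / 8" 1])
  show "\<forall>\<^sub>F m in inf sequentially (principal {m. odd m}).
      1 / 8 * norm (1 / (real m)\<^sup>2) \<le> norm (rho2 m - sqrt (3 / 4)) \<and>
      norm (rho2 m - sqrt (3 / 4)) \<le> 1 * norm (1 / (real m)\<^sup>2)"
    unfolding eventually_inf_principal
  proof (intro always_eventually allI impI)
    fix m :: nat assume "m \<in> {m. odd m}"
    then have "odd m" by simp
    define s where "s = sqrt (3 / 4 :: real)"
    define r where "r = rho2 m"
    define x where "x = 1 / (real m)\<^sup>2"
    have "m \<ge> 1" using \<open>odd m\<close> by (cases m) auto
    then have x: "0 < x" "x \<le> 1" by (simp_all add: x_def)
    have r: "r = sqrt (3 / 4 + x / 4)" using rho2_odd[OF \<open>odd m\<close>] by (simp add: r_def x_def)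
    have "r\<^sup>2 - s\<^sup>2 = x / 4" using x by (simp add: r s_def)
    then have eq: "(r - s) * (r + s) = x / 4" by (simp add: power2_eq_square algebra_simps)
    have "s \<ge> 1 / 2" unfolding s_def by (rule real_le_rsqrt) (simp add: power2_eq_square)
    have "r \<le> 1" using x by (simp add: r)
    have "s \<le> r" using x by (simp add: r s_def)
    have "1 \<le> r + s" "r + s \<le> 2" using \<open>s \<ge> 1 / 2\<close> \<open>s \<le> r\<close> \<open>r \<le> 1\<close> by linarith+
    then have "(r - s) * 1 \<le> (r - s) * (r + s)" "(r - s) * (r + s) \<le> (r - s) * 2"
      using \<open>s \<le> r\<close> by (intro mult_left_mono; simp)+
    then have "1 / 8 * x \<le> r - s" "r - s \<le> x" using x unfolding eq by simp_all
    then show "1 / 8 * norm (1 / (real m)\<^sup>2) \<le> norm (rho2 m - sqrt (3 / 4)) \<and>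
      norm (rho2 m - sqrt (3 / 4)) \<le> 1 * norm (1 / (real m)\<^sup>2)"
      using \<open>s \<le> r\<close> by (simp add: x_def r_def s_def)
  qed
qed simp_all

theorem theorem7p1:
  shows "(\<forall>m\<ge>1. rho2 m = sqrt (real_of_int \<lceil>3 * (real m)\<^sup>2 / 4\<rceil> / (real m)\<^sup>2)) \<and>
         (\<forall>m\<ge>1. even m \<longrightarrow> rho2 m = sqrt (3 / 4)) \<and>
         (\<lambda>m. rho2 m - sqrt (3 / 4))
           \<in> \<Theta>[inf sequentially (principal {m. odd m})](\<lambda>m. 1 / (real m)\<^sup>2)"
  using rho2_formula rho2_even rho2_odd_bigtheta by blast

end
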